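(* For all $p,q\in(-\infty,1]$ the equality $\mathcal{H}(\mathcal{P}_p\mathbin{\square}\mathcal{P}_q)=\varrho_{p,q}$ holds. If, additionally, $p>q$, then also $\mathcal{H}(\mathcal{P}_p\circ\mathcal{P}_q)=\varrho_{p,q}$. Here $$\varrho_{p,q}=\begin{cases}\Big(\iint_{[0,1]^2}\big(\frac{x^{-q}+y^{-q}}2\big)^{\frac pq}\,dx\,dy\Big)^{\frac1p}&\text{if }pq\ne0,\\[1mm] \exp\Big(\frac1q\iint_{[0,1]^2}\ln\big(\frac{x^{-q}+y^{-q}}2\big)\,dx\,dy\Big)&\text{if }p=0,\ q\neq0,\\[1mm] \Big(\int_0^1x^{-\frac p2}\,dx\Big)^{\frac2p}&\text{if }p\ne0,\ q=0,\\[1mm] e&\text{if }p=q=0.\end{cases}$$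
   Context: Let $\mathbb{N}=\{1,2,\dots\}$, $\mathbb{N}_n=\{1,\dots,n\}$, $\mathbb{R}_+=(0,\infty)$. For $p\in\mathbb{R}$ the $p$-th power mean of $x_1,\dots,x_n\in\mathbb{R}_+$ is $\mathcal{P}_p(x_1,\dots,x_n)=\big(\frac{x_1^p+\dots+x_n^p}n\big)^{1/p}$ if $p\neq0$, and $\mathcal{P}_0(x_1,\dots,x_n)=\sqrt[n]{x_1\cdots x_n}$. A mean on $\mathbb{R}_+$ is a function $\mathcal{M}\colon\bigcup_{n=1}^\infty\mathbb{R}_+^n\to\mathbb{R}_+$ with $\min\le\mathcal{M}\le\max$. Its Hardy constant $\mathcal{H}(\mathcal{M})$ is the smallest extended real number $C$ such that $\sum_{n=1}^\infty\mathcal{M}(x_1,\dots,x_n)\le C\sum_{n=1}^\infty x_n$ for all summable sequences $(x_n)_{n=1}^\infty$ in $\mathbb{R}_+$ (it may be $+\infty$). Mixed means: for a symmetric mean $\mathcal{M}\colon\bigcup_{n=1}^\infty\mathbb{R}_+^n\to\mathbb{R}_+$ and $\mathcal{N}\colon\mathbb{R}_+^2\to\mathbb{R}_+$, define $\mathcal{M}\circ\mathcal{N}(x_1)=x_1$ for $n=1$, and for $n\ge2$, $\mathcal{M}\circ\mathcal{N}(x_1,\dots,x_n)=\mathcal{M}\big(\mathcal{N}(x_i,x_j)\colon1\le i<j\le n\big)$ (a vector of $\binom n2$ entries); and for $n\geq 1$, $\mathcal{M}\mathbin{\square}\mathcal{N}(x_1,\dots,x_n)=\mathcal{M}\big(\mathcal{N}(x_i,x_j)\colon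 i,j\in\mathbb{N}_n\big)$ (a vector of $n^2$ entries). In $\mathcal{P}_p\circ\mathcal{P}_q$ and $\mathcal{P}_p\mathbin{\square}\mathcal{P}_q$ the second mean is restricted to two variables. If the integral defining $\varrho_{p,q}$ diverges to $+\infty$, then $\varrho_{p,q}=+\infty$. *)

theory Defs
  imports "HOL-Analysis.Analysis"
begin

text \<open>A function on \<open>\<Union>\<^sub>n \<real>\<^sub>+\<^sup>n\<close> is modelled as a function on real lists; only its values on
  nonempty lists of positive reals matter.\<close>

definition power_mean :: "real \<Rightarrow> real list \<Rightarrow> real" where
  "power_mean p xs =
     (if p = 0 then root (length xs) (prod_list xs)
      else ((\<Sum>x\<leftarrow>xs. x powr p) / real (length xs)) powr (1 / p))"

text \<open>The sequence \<open>x\<close> is indexed from 0, so the \<open>n\<close>-th term on the left is the mean of the first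
  \<open>n + 1\<close> entries. For a mean \<open>M\<close> that series has positive terms and is summed in the
  extended reals, so it may be infinite.\<close>

definition hardy_const :: "(real list \<Rightarrow> real) \<Rightarrow> ereal" where
  "hardy_const M =
     (LEAST C. \<forall>x::nat \<Rightarrow> real. (\<forall>n. 0 < x n) \<longrightarrow> summable x \<longrightarrow>
        (\<Sum>n. ereal (M (map x [0..<Suc n]))) \<le> C * ereal (\<Sum>n. x n))"

text \<open>In both mixed means the entries are listed in lexicographic order of the index pairs; the
  order is irrelevant for symmetric \<open>M\<close>.\<close>

definition mean_circ :: "(real list \<Rightarrow> real) \<Rightarrow> (real \<Rightarrow> real \<Rightarrow> real) \<Rightarrow> real list \<Rightarrow> real" where
  "mean_circ M N xs =
     (if length xs = 1 then hd xs
      else M [N (xs ! i) (xs ! j). i \<leftarrow> [0..<length xs], j \<leftarrow> [Suc i..<length xs]])"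

definition mean_square :: "(real list \<Rightarrow> real) \<Rightarrow> (real \<Rightarrow> real \<Rightarrow> real) \<Rightarrow> real list \<Rightarrow> real" where
  "mean_square M N xs =
     M [N (xs ! i) (xs ! j). i \<leftarrow> [0..<length xs], j \<leftarrow> [0..<length xs]]"

text \<open>The integrands below have constant sign off the coordinate axes, so failure of
  integrability means that the integral diverges; the value is then \<open>\<infinity>\<close> by convention. On the
  axes, a null set, \<open>0 powr a = 0\<close> and \<open>ln 0 = 0\<close> give the integrands irrelevant finite values.\<close>

definition rho :: "real \<Rightarrow> real \<Rightarrow> ereal" where
  "rho p q =
     (if p \<noteq> 0 \<and> q \<noteq> 0 then
        (let S = {0..1} \<times> {0..1};
             f = (\<lambda>(x::real, y::real). ((x powr (- q) + y powr (- q)) / 2) powr (p / q))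
         in if set_integrable lborel S f
            then ereal (set_lebesgue_integral lborel S f powr (1 / p)) else \<infinity>)
      else if p = 0 \<and> q \<noteq> 0 then
        (let S = {0..1} \<times> {0..1};
             f = (\<lambda>(x::real, y::real). ln ((x powr (- q) + y powr (- q)) / 2))
         in if set_integrable lborel S f
            then ereal (exp (1 / q * set_lebesgue_integral lborel S f)) else \<infinity>)
      else if p \<noteq> 0 \<and> q = 0 then
        (let f = (\<lambda>x::real. x powr (- p / 2))
         in if set_integrable lborel {0..1} f
            then ereal (set_lebesgue_integral lborel {0..1} f powr (2 / p)) else \<infinity>)
      else ereal (exp 1))"

end

theory Submission
  imports Defs
begin

text \<open>
  With \<open>\<psi>\<^sub>p(t) = (t\<^sup>p - 1) / p\<close> (and \<open>\<psi>\<^sub>0 = ln\<close>) the mean \<open>P\<^sub>p\<close> is quasi-arithmetic with generator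
  \<open>\<psi>\<^sub>p\<close>. The relation \<open>\<psi>\<^sub>p(s t) = \<psi>\<^sub>p(s) + s\<^sup>p \<psi>\<^sub>p(t)\<close> and the monotonicity of \<open>\<psi>\<^sub>p\<close> in \<open>p\<close>
  give its tangent line inequality for \<open>p \<le> 1\<close>, and all concavity used below. Since \<open>P\<^sub>p \<square> P\<^sub>q\<close> is then
  concave, homogeneous and invariant under repetitions, Kedlaya's argument applies: writing the
  averages \<open>A\<^sub>j = (x\<^sub>1 + \<dots> + x\<^sub>j) / j\<close> as \<open>(1/n) \<Sum>\<^sub>i y\<^sub>j\<^sup>i\<close>, where each \<open>y\<^sup>i\<close> is a bistochastic mixture of
  \<open>x\<^sub>1, \<dots>, x\<^sub>i\<close>, one obtains \<open>\<Sum>\<^sub>i\<^sub>\<le>\<^sub>n M(x\<^sub>1, \<dots>, x\<^sub>i) \<le> S \<cdot> M(n/1, \<dots>, n/n)\<close> with \<open>S = x\<^sub>1 + \<dots> + x\<^sub>n\<close>.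
  The right-hand mean is a lower Riemann sum of the integral defining \<open>\<rho>\<close>, which is the upper
  bound; \<open>P\<^sub>p \<circ> P\<^sub>q \<le> P\<^sub>p \<square> P\<^sub>q\<close> for \<open>q \<le> p\<close> transfers it. Conversely these Riemann sums converge
  to the integral, even without their diagonal terms, so the harmonic sequence cut off at a late
  index shows that no smaller constant is possible.
\<close>

section \<open>Power means\<close>

definition psi :: "real \<Rightarrow> real \<Rightarrow> real" where
  "psi p t = (if p = 0 then ln t else (t powr p - 1) / p)"

lemma psi_one [simp]: "psi p 1 = 0"
  by (simp add: psi_def)

lemma psi_mult:
  assumes "0 < s" "0 < t"
  shows "psi p (s * t) = psi p s + s powr p * psi p t"
  using assms by (auto simp: psi_def ln_mult powr_mult field_simps)

lemma DERIV_psi: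
  assumes "0 < t"
  shows "(psi p has_real_derivative t powr (p - 1)) (at t)"
proof (cases "p = 0")
  case True
  then have "psi p = ln" by (simp add: psi_def fun_eq_iff)
  moreover have "(ln has_real_derivative t powr (p - 1)) (at t)"
    using assms True by (auto intro!: derivative_eq_intros simp: powr_minus_divide)
  ultimately show ?thesis by simp
next
  case False
  then have "psi p = (\<lambda>t. (t powr p - 1) / p)" by (simp add: psi_def fun_eq_iff)
  moreover have "((\<lambda>t. (t powr p - 1) / p) has_real_derivative t powr (p - 1)) (at t)"
    using assms False by (auto intro!: derivative_eq_intros)
  ultimately show ?thesis by simp
qed

text \<open>The difference \<open>psi p - psi q\<close> vanishes at 1, and its derivative
  \<open>t powr (p - 1) - t powr (q - 1)\<close> is nonpositive before 1 and nonnegative after it,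
  so 1 is a minimum.\<close>

lemma psi_mono_exponent:
  assumes "q \<le> p" "0 < t"
  shows "psi q t \<le> psi p t"
proof -
  let ?d = "\<lambda>t. psi p t - psi q t"
  have D: "(?d has_real_derivative s powr (p - 1) - s powr (q - 1)) (at s)" if "0 < s" for s
    using that by (intro DERIV_diff DERIV_psi)
  have "?d 1 \<le> ?d t"
  proof (cases "1 \<le> t")
    case True
    have "\<exists>y. (?d has_real_derivative y) (at s) \<and> 0 \<le> y" if "1 \<le> s" for s
      using D[of s] that assms by (intro exI[of _ "s powr (p - 1) - s powr (q - 1)"]) (auto intro: powr_mono)
    then show ?thesis
      using True by (intro DERIV_nonneg_imp_nondecreasing[of 1 t ?d]) auto
  next
    case False
    have "\<exists>y. (?d has_real_derivative y) (at s) \<and> y \<le> 0" if "t \<le> s" "s \<le> 1" for s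
      using D[of s] that assms
      by (intro exI[of _ "s powr (p - 1) - s powr (q - 1)"]) (auto intro: powr_mono')
    then show ?thesis
      using False by (intro DERIV_nonpos_imp_nonincreasing[of t 1 ?d]) auto
  qed
  then show ?thesis by simp
qed

text \<open>At \<open>s = 1\<close> this is the comparison with exponent 1, since
  \<open>psi 1 t = t - 1\<close>; the general point follows by scaling with
  \<open>psi_mult\<close>.\<close>

lemma psi_tangent:
  assumes "p \<le> 1" "0 < s" "0 < t"
  shows "psi p t \<le> psi p s + s powr (p - 1) * (t - s)"
proof -
  have "psi p (t / s) \<le> psi 1 (t / s)"
    using assms by (intro psi_mono_exponent) auto
  also have "\<dots> = t / s - 1"
    using assms by (simp add: psi_def)
  finally have "s powr p * psi p (t / s) \<le> s powr p * (t / s - 1)"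
    by (intro mult_left_mono) auto
  also have "\<dots> = s powr (p - 1) * (t - s)"
    using assms by (simp add: powr_diff field_simps)
  finally show ?thesis
    using psi_mult[of s "t / s" p] assms by simp
qed

lemma psi_less:
  assumes "0 < s" "s < t"
  shows "psi p s < psi p t"
proof -
  have "\<exists>y. (psi p has_real_derivative y) (at u) \<and> 0 < y" if "s \<le> u" "u \<le> t" for u
  proof (intro exI conjI)
    have "0 < u" using that assms by simp
    then show "(psi p has_real_derivative u powr (p - 1)) (at u)" "0 < u powr (p - 1)"
      by (simp_all add: DERIV_psi)
  qed
  then show ?thesis
    by (rule DERIV_pos_imp_increasing[OF assms(2)])
qed

lemma psi_le_iff:
  assumes "0 < s" "0 < t"
  shows "psi p s \<le> psi p t \<longleftrightarrow> s \<le> t"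
  using psi_less[of s t p] psi_less[of t s p] assms by (cases s t rule: linorder_cases) auto

lemma psi_inject: "0 < s \<Longrightarrow> 0 < t \<Longrightarrow> psi p s = psi p t \<Longrightarrow> s = t"
  using psi_less[of s t p] psi_less[of t s p] by (cases s t rule: linorder_cases) auto

lemma psi_nonneg: "1 \<le> t \<Longrightarrow> 0 \<le> psi p t"
  using psi_le_iff[of 1 t p] by simp

text \<open>The tangent inequality at the weighted average \<open>s\<close> is summed; as the
  weights add up to 1, the linear terms cancel.\<close>

lemma psi_jensen:
  assumes "p \<le> 1" "finite I" "\<And>i. i \<in> I \<Longrightarrow> 0 \<le> w i" "\<And>i. i \<in> I \<Longrightarrow> 0 < t i" "sum w I = 1"
  shows "(\<Sum>i\<in>I. w i * psi p (t i)) \<le> psi p (\<Sum>i\<in>I. w i * t i)"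
proof -
  define s where "s = (\<Sum>i\<in>I. w i * t i)"
  \<comment> \<open>Some weight is positive, which makes \<open>s\<close> positive, as the tangent
    inequality requires.\<close>
  obtain i where "i \<in> I" "0 < w i"
    using assms(3,5) by (metis less_eq_real_def sum.neutral zero_neq_one)
  then have "0 < s"
    unfolding s_def using assms(2-4) by (intro sum_pos2[of I i]) (auto intro!: mult_nonneg_nonneg intro: less_imp_le)
  then have "(\<Sum>i\<in>I. w i * psi p (t i)) \<le> (\<Sum>i\<in>I. w i * (psi p s + s powr (p - 1) * (t i - s)))"
    using assms by (intro sum_mono mult_left_mono psi_tangent) auto
  also have "\<dots> = sum w I * psi p s + s powr (p - 1) * ((\<Sum>i\<in>I. w i * t i) - sum w I * s)"
    by (simp add: algebra_simps sum.distrib sum_subtractf sum_distrib_left sum_distrib_right)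
  finally show ?thesis by (simp add: s_def[symmetric] assms(5))
qed

section \<open>Power means as quasi-arithmetic means\<close>

lemma prod_list_pos: "(\<And>x. x \<in> set xs \<Longrightarrow> 0 < x) \<Longrightarrow> 0 < prod_list (xs :: real list)"
  by (induction xs) auto

lemma ln_prod_list: "(\<And>x. x \<in> set xs \<Longrightarrow> 0 < x) \<Longrightarrow> ln (prod_list xs) = (\<Sum>x\<leftarrow>xs. ln (x::real))"
  by (induction xs) (auto simp: ln_mult_pos prod_list_pos)

lemma sum_list_pos: "xs \<noteq> [] \<Longrightarrow> (\<And>x. x \<in> set xs \<Longrightarrow> 0 < f x) \<Longrightarrow> 0 < (\<Sum>x\<leftarrow>xs. f x :: real)"
  by (induction xs rule: list_nonempty_induct) (auto intro: add_pos_pos)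

lemma power_mean_pos:
  assumes "xs \<noteq> []" "\<And>x. x \<in> set xs \<Longrightarrow> 0 < x"
  shows "0 < power_mean p xs"
proof (cases "p = 0")
  case True
  then show ?thesis using assms prod_list_pos[of xs] by (simp add: power_mean_def)
next
  case False
  have "0 < (\<Sum>x\<leftarrow>xs. x powr p)"
    by (rule sum_list_pos[OF assms(1)]) (use assms in force)
  then show ?thesis using False assms by (simp add: power_mean_def)
qed

text \<open>The generator turns the power mean into an arithmetic mean, which lets the inequalities
  below treat \<open>p = 0\<close> together with the other exponents.\<close>

lemma sum_list_psi:
  assumes "xs \<noteq> []" "\<And>x. x \<in> set xs \<Longrightarrow> 0 < x"
  shows "(\<Sum>x\<leftarrow>xs. psi p x) = length xs * psi p (power_mean p xs)"
proof (cases "p = 0")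
  case True
  then show ?thesis
    using assms prod_list_pos[of xs] ln_prod_list[of xs]
    by (simp add: power_mean_def psi_def ln_root)
next
  case False
  have pos: "0 < (\<Sum>x\<leftarrow>xs. x powr p)"
    by (rule sum_list_pos[OF assms(1)]) (use assms in force)
  have "(\<Sum>x\<leftarrow>xs. psi p x) = ((\<Sum>x\<leftarrow>xs. x powr p) - length xs) / p"
    using False by (induction xs) (auto simp: psi_def field_simps)
  also have "\<dots> = length xs * psi p (power_mean p xs)"
    using pos False assms by (simp add: power_mean_def psi_def powr_powr field_simps)
  finally show ?thesis .
qed

text \<open>\<open>psi p (c * x)\<close> is affine in \<open>psi p x\<close>, so scaling passes
  through the average. With \<open>c\<close> the reciprocal of the mean the sum is zero; this
  normalisation recurs below.\<close>

lemma sum_list_psi_scaled: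
  assumes "xs \<noteq> []" "\<And>x. x \<in> set xs \<Longrightarrow> 0 < x" "0 < c"
  shows "(\<Sum>x\<leftarrow>xs. psi p (c * x)) = length xs * psi p (c * power_mean p xs)"
proof -
  have "(\<Sum>x\<leftarrow>xs. psi p (c * x)) = (\<Sum>x\<leftarrow>xs. psi p c + c powr p * psi p x)"
    using assms by (intro arg_cong[where f = sum_list] map_cong refl psi_mult) auto
  also have "\<dots> = length xs * psi p c + c powr p * (\<Sum>x\<leftarrow>xs. psi p x)"
    by (simp add: sum_list_addf sum_list_const_mult sum_list_triv)
  also have "\<dots> = length xs * psi p (c * power_mean p xs)"
    using assms power_mean_pos[OF assms(1,2)] by (simp add: sum_list_psi psi_mult algebra_simps)
  finally show ?thesis .
qed

section \<open>Power means of two variables\<close>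

abbreviation mean2 :: "real \<Rightarrow> real \<Rightarrow> real \<Rightarrow> real" where
  "mean2 q a b \<equiv> power_mean q [a, b]"

lemma mean2_pos: "0 < a \<Longrightarrow> 0 < b \<Longrightarrow> 0 < mean2 q a b"
  by (rule power_mean_pos) auto

lemma mean2_commute: "mean2 q a b = mean2 q b a"
  by (simp add: power_mean_def add.commute mult.commute)

lemma psi_mean2_scaled:
  assumes "0 < a" "0 < b" "0 < c"
  shows "psi q (c * a) + psi q (c * b) = 2 * psi q (c * mean2 q a b)"
  using sum_list_psi_scaled[of "[a, b]" c q] assms by auto

lemma mean2_self: "0 < a \<Longrightarrow> mean2 q a a = a"
  using psi_mean2_scaled[of a a 1 q] psi_inject[of "mean2 q a a" a q] mean2_pos[of a a q] by simp

lemma mean2_mult: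
  assumes "0 < a" "0 < b" "0 < c"
  shows "mean2 q (c * a) (c * b) = c * mean2 q a b"
proof (rule psi_inject[of _ _ q])
  show "psi q (mean2 q (c * a) (c * b)) = psi q (c * mean2 q a b)"
    using psi_mean2_scaled[of a b c q] psi_mean2_scaled[of "c * a" "c * b" 1 q] assms by simp
qed (use assms in \<open>simp_all add: mean2_pos\<close>)

lemma mean2_mono:
  assumes "0 < a" "0 < b" "a \<le> a'" "b \<le> b'"
  shows "mean2 q a b \<le> mean2 q a' b'"
proof -
  have "psi q a \<le> psi q a'" "psi q b \<le> psi q b'"
    using assms by (auto simp: psi_le_iff)
  then have "psi q (mean2 q a b) \<le> psi q (mean2 q a' b')"
    using psi_mean2_scaled[of a b 1 q] psi_mean2_scaled[of a' b' 1 q] assms by simp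
  then show ?thesis
    using assms by (simp add: psi_le_iff mean2_pos)
qed

text \<open>Dividing \<open>a\<close> and \<open>b\<close> by their \<open>q\<close>-mean makes the
  \<open>psi q\<close> values add up to zero, so the larger \<open>psi p\<close> values have a
  nonnegative sum; scaling back gives the claim. It expresses monotonicity of the mean in its
  exponent.\<close>

lemma psi_mean2_le:
  assumes "q \<le> p" "0 < a" "0 < b"
  shows "psi p (mean2 q a b) \<le> (psi p a + psi p b) / 2"
proof -
  define m where "m = mean2 q a b"
  have m: "0 < m" using assms by (simp add: m_def mean2_pos)
  have "psi q (1 / m * a) + psi q (1 / m * b) = 0"
    using psi_mean2_scaled[of a b "1 / m" q] m assms by (simp add: m_def)
  moreover have "psi q (1 / m * a) \<le> psi p (1 / m * a)" "psi q (1 / m * b) \<le> psi p (1 / m * b)"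
    using assms m by (auto intro: psi_mono_exponent)
  ultimately have "0 \<le> m powr p * (psi p (1 / m * a) + psi p (1 / m * b))"
    by simp
  then show ?thesis
    using psi_mult[of m "1 / m * a" p] psi_mult[of m "1 / m * b" p] m assms
    by (simp add: m_def[symmetric] algebra_simps)
qed

text \<open>The mean lies below its tangent plane at the summed point, whose gradient is \<open>(\<alpha>, \<beta>) / 2\<close>.\<close>

lemma mean2_superadditive:
  assumes "q \<le> 1" "finite I" "\<And>i. i \<in> I \<Longrightarrow> 0 \<le> c i"
    and "\<And>i. i \<in> I \<Longrightarrow> 0 < a i" "\<And>i. i \<in> I \<Longrightarrow> 0 < b i"
    and "0 < (\<Sum>i\<in>I. c i * a i)" "0 < (\<Sum>i\<in>I. c i * b i)"
  shows "(\<Sum>i\<in>I. c i * mean2 q (a i) (b i)) \<le> mean2 q (\<Sum>i\<in>I. c i * a i) (\<Sum>i\<in>I. c i * b i)"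
proof -
  define A where "A = (\<Sum>i\<in>I. c i * a i)"
  define B where "B = (\<Sum>i\<in>I. c i * b i)"
  define m where "m = mean2 q A B"
  have AB: "0 < A" "0 < B" and m: "0 < m"
    using assms by (auto simp: A_def B_def m_def mean2_pos)
  define \<alpha> where "\<alpha> = (A / m) powr (q - 1)"
  define \<beta> where "\<beta> = (B / m) powr (q - 1)"
  have eq0: "psi q (A / m) + psi q (B / m) = 0"
    using psi_mean2_scaled[of A B "1 / m" q] m AB by (simp add: m_def)
  \<comment> \<open>Euler's identity for a function homogeneous of degree 1: the gradient
    \<open>(\<alpha>, \<beta>) / 2\<close> at \<open>(A, B)\<close>, paired with
    \<open>(A, B)\<close>, gives \<open>m\<close>.\<close>
  then have eq2: "\<alpha> * (A / m) + \<beta> * (B / m) = 2"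
    using AB m by (cases "q = 0") (auto simp: psi_def \<alpha>_def \<beta>_def powr_diff divide_simps)
  \<comment> \<open>The tangent lines of \<open>psi q\<close> at \<open>A / m\<close> and
    \<open>B / m\<close> are added and evaluated at \<open>s / u\<close> and \<open>t / u\<close>.
    By homogeneity the resulting plane has no constant term, so it can be summed against any
    nonnegative weights \<open>c\<close>.\<close>
  have support: "2 * mean2 q s t \<le> \<alpha> * s + \<beta> * t" if "0 < s" "0 < t" for s t
  proof -
    define u where "u = mean2 q s t"
    have u: "0 < u" using that by (simp add: u_def mean2_pos)
    have "0 = psi q (s / u) + psi q (t / u)"
      using psi_mean2_scaled[of s t "1 / u" q] u that by (simp add: u_def)
    also have "\<dots> \<le> (psi q (A / m) + \<alpha> * (s / u - A / m)) + (psi q (B / m) + \<beta> * (t / u - B / m))"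
      unfolding \<alpha>_def \<beta>_def using assms(1) that AB m u by (intro add_mono psi_tangent) auto
    also have "\<dots> = (\<alpha> * s + \<beta> * t) / u - 2"
      using eq0 eq2 by (simp add: algebra_simps add_divide_distrib)
    finally show ?thesis
      using u by (simp add: u_def[symmetric] field_simps)
  qed
  have "2 * (\<Sum>i\<in>I. c i * mean2 q (a i) (b i)) = (\<Sum>i\<in>I. c i * (2 * mean2 q (a i) (b i)))"
    by (simp add: sum_distrib_left mult_ac)
  also have "\<dots> \<le> (\<Sum>i\<in>I. c i * (\<alpha> * a i + \<beta> * b i))"
    using assms by (intro sum_mono mult_left_mono support) auto
  also have "\<dots> = \<alpha> * A + \<beta> * B"
    by (simp add: A_def B_def algebra_simps sum.distrib sum_distrib_left)
  also have "\<dots> = 2 * m"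
    using eq2 m by (simp add: field_simps)
  finally show ?thesis by (simp add: m_def A_def B_def)
qed

section \<open>Kedlaya's coefficients\<close>

text \<open>Subsets of \<open>{0..N}\<close> with \<open>k + l + 1\<close> elements are counted by
  their element \<open>i\<close> of rank \<open>k + 1\<close>: \<open>k\<close> elements lie below
  \<open>i\<close> and \<open>l\<close> above. The induction uses Pascal's rule on the second
  factor, starting from the hockey-stick identity at \<open>l = 0\<close>.\<close>

lemma sum_choose_mult_choose:
  "(\<Sum>i\<le>N. (i choose k) * ((N - i) choose l)) = Suc N choose (Suc (k + l))"
proof (induction N arbitrary: l)
  case 0
  show ?case by (cases k; cases l) auto
next
  case (Suc N)
  show ?case
  proof (cases l)
    case 0
    then show ?thesis using sum_choose_upper[of k "Suc N"] by simp
  next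
    case l: (Suc l')
    have "(\<Sum>i\<le>Suc N. (i choose k) * ((Suc N - i) choose l))
        = (\<Sum>i\<le>N. (i choose k) * ((N - i) choose l') + (i choose k) * ((N - i) choose l))"
      by (simp add: l Suc_diff_le algebra_simps)
    then show ?thesis
      using Suc.IH[of l] Suc.IH[of l'] by (simp add: l sum.distrib)
  qed
qed

text \<open>\<open>kedlaya N i j k\<close> is the probability that a random \<open>j\<close>-element subset of an \<open>N\<close>-element set
  meets a fixed \<open>i\<close>-element subset in \<open>k\<close> elements; the indices are one less than in Kedlaya's paper.
  The case split is needed because \<open>j - k\<close> truncates.\<close>

definition kedlaya :: "nat \<Rightarrow> nat \<Rightarrow> nat \<Rightarrow> nat \<Rightarrow> real" where
  "kedlaya N i j k =
     (if k \<le> j then real (((N - i) choose (j - k)) * (i choose k)) / real (N choose j) else 0)"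

lemma kedlaya_nonneg: "0 \<le> kedlaya N i j k"
  by (simp add: kedlaya_def)

lemma kedlaya_eq_0: "i < k \<or> j < k \<Longrightarrow> kedlaya N i j k = 0"
  by (auto simp: kedlaya_def)

text \<open>The overlap of two sets has the same distribution whichever of them is random. With
  \<open>i = k + a\<close>, \<open>j = k + b\<close>, \<open>N = k + a + b + c\<close>, both sides
  are the same quotient of factorials, symmetric in \<open>a\<close> and \<open>b\<close>.\<close>

lemma kedlaya_commute:
  assumes "i \<le> N" "j \<le> N"
  shows "kedlaya N i j k = kedlaya N j i k"
proof (cases "k \<le> i \<and> k \<le> j")
  case False
  then show ?thesis by (auto simp: kedlaya_eq_0 not_le)
next
  case True
  show ?thesis
  proof (cases "i + j - k \<le> N")
    case False
    \<comment> \<open>So small an overlap is impossible, and both sides contain a vanishing binomial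
      coefficient.\<close>
    then have "N - i < j - k" "N - j < i - k" using assms True by auto
    then show ?thesis using True by (simp add: kedlaya_def binomial_eq_0)
  next
    case le: True
    obtain a where a: "i = k + a" using True le_Suc_ex by blast
    obtain b where b: "j = k + b" using True le_Suc_ex by blast
    obtain c where c: "N = k + a + b + c" using le a b le_Suc_ex by fastforce
    have *: "real ((k + a + b + c) choose m) = fact (k + a + b + c) / (fact m * fact (k + a + b + c - m))"
      if "m \<le> k + a + b + c" for m
      using that by (rule binomial_fact)
    have 1: "real ((b + c) choose b) = fact (b + c) / (fact b * fact c)"
      "real ((a + c) choose a) = fact (a + c) / (fact a * fact c)"
      "real ((k + a) choose k) = fact (k + a) / (fact k * fact a)"
      "real ((k + b) choose k) = fact (k + b) / (fact k * fact b)"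
      using binomial_fact[of b "b + c", where ?'a = real] binomial_fact[of a "a + c", where ?'a = real]
        binomial_fact[of k "k + a", where ?'a = real] binomial_fact[of k "k + b", where ?'a = real] by simp_all
    have 2: "k + a + b + c - (k + a) = b + c" "k + a + b + c - (k + b) = a + c" by simp_all
    show ?thesis
      unfolding kedlaya_def a b c of_nat_mult 2
      using *[of "k + a"] *[of "k + b"] by (simp add: 1 2 mult_ac)
  qed
qed

text \<open>Total probability, by Vandermonde's identity. The coefficients are therefore weights of
  an average over \<open>k\<close>.\<close>

lemma sum_kedlaya_mean:
  assumes "i \<le> N" "j \<le> N"
  shows "(\<Sum>k\<le>i. kedlaya N i j k) = 1"
proof -
  have "(\<Sum>k\<le>i. kedlaya N i j k) = (\<Sum>k\<le>j. kedlaya N i j k)"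
    by (rule sum.mono_neutral_cong) (auto simp: kedlaya_eq_0)
  also have "\<dots> = real (\<Sum>k\<le>j. (i choose k) * ((N - i) choose (j - k))) / real (N choose j)"
    by (simp add: kedlaya_def sum_divide_distrib mult.commute)
  also have "\<dots> = 1"
    unfolding vandermonde using assms by simp
  finally show ?thesis .
qed

text \<open>The counting identity above, followed by absorption of \<open>j + 1\<close>. Summed over
  \<open>i\<close>, the weighted averages of \<open>x\<close> thus give \<open>N + 1\<close> times
  the plain average of \<open>x 0\<close>, ..., \<open>x j\<close>.\<close>

lemma sum_kedlaya_fst:
  assumes "k \<le> j" "j \<le> N"
  shows "(\<Sum>i\<le>N. kedlaya N i j k) = real (Suc N) / real (Suc j)"
proof -
  have "(\<Sum>i\<le>N. kedlaya N i j k) = real (\<Sum>i\<le>N. (i choose k) * ((N - i) choose (j - k))) / real (N choose j)"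
    using assms by (simp add: kedlaya_def sum_divide_distrib mult.commute)
  also have "\<dots> = real (Suc N choose Suc j) / real (N choose j)"
    unfolding sum_choose_mult_choose using assms by simp
  also have "\<dots> = real (Suc N) / real (Suc j)"
  proof -
    have "real (Suc j) * real (Suc N choose Suc j) = real (Suc N) * real (N choose j)"
      using Suc_times_binomial[of j N] by (simp only: of_nat_mult[symmetric])
    moreover have "real (N choose j) \<noteq> 0" using assms by simp
    ultimately show ?thesis by (simp add: field_simps del: binomial_Suc_Suc)
  qed
  finally show ?thesis .
qed

text \<open>This is the other half of bistochasticity: over all \<open>j\<close>, each
  \<open>x k\<close> with \<open>k \<le> i\<close> receives the same total weight.\<close>

lemma sum_kedlaya_snd:
  assumes "k \<le> i" "i \<le> N"
  shows "(\<Sum>j\<le>N. kedlaya N i j k) = real (Suc N) / real (Suc i)"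
  using sum_kedlaya_fst[OF assms] assms by (simp add: kedlaya_commute)

section \<open>Mixed means and a Kedlaya-type inequality\<close>

abbreviation square_mean :: "real \<Rightarrow> real \<Rightarrow> real list \<Rightarrow> real" where
  "square_mean p q \<equiv> mean_square (power_mean p) (\<lambda>x y. power_mean q [x, y])"

abbreviation circ_mean :: "real \<Rightarrow> real \<Rightarrow> real list \<Rightarrow> real" where
  "circ_mean p q \<equiv> mean_circ (power_mean p) (\<lambda>x y. power_mean q [x, y])"

lemma sum_square_symmetric:
  fixes g :: "nat \<Rightarrow> nat \<Rightarrow> real"
  assumes "\<And>i j. g i j = g j i"
  shows "(\<Sum>i<n. \<Sum>j<n. g i j) = 2 * (\<Sum>i<n. \<Sum>j\<in>{Suc i..<n}. g i j) + (\<Sum>i<n. g i i)"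
proof (induction n)
  case (Suc n)
  have "(\<Sum>i<Suc n. \<Sum>j\<in>{Suc i..<Suc n}. g i j) = (\<Sum>i<n. (\<Sum>j\<in>{Suc i..<n}. g i j) + g i n)"
    by (simp add: sum.atLeastLessThan_Suc)
  moreover have "(\<Sum>i<n. g n i) = (\<Sum>i<n. g i n)"
    using assms by (intro sum.cong) auto
  ultimately show ?case
    using Suc.IH by (simp add: sum.distrib)
qed simp

lemma sum_list_map_concat: "(\<Sum>z\<leftarrow>concat zss. f z) = (\<Sum>zs\<leftarrow>zss. \<Sum>z\<leftarrow>zs. f z)"
  by (induction zss) auto

text \<open>Rewrites the list of \<open>n * n\<close> entries as a double sum over indices, so that
  sums can be exchanged and split. The factor \<open>c\<close> carries the normalisations used
  later.\<close>

lemma psi_square_mean_scaled: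
  assumes "\<And>i. 0 < x i" "0 < n" "0 < c"
  shows "(\<Sum>i<n. \<Sum>j<n. psi p (c * mean2 q (x i) (x j)))
    = (real n)\<^sup>2 * psi p (c * square_mean p q (map x [0..<n]))"
    and "0 < square_mean p q (map x [0..<n])"
proof -
  define zs where "zs = concat (map (\<lambda>i. map (\<lambda>j. mean2 q (x i) (x j)) [0..<n]) [0..<n])"
  have sq: "square_mean p q (map x [0..<n]) = power_mean p zs"
    unfolding mean_square_def zs_def
    by (intro arg_cong[where f = "power_mean p"] arg_cong[where f = concat] map_cong) auto
  have len: "length zs = n * n"
    by (simp add: zs_def length_concat o_def sum_list_triv)
  then have ne: "zs \<noteq> []" using assms by auto
  have pos: "0 < z" if "z \<in> set zs" for z
    using that assms by (auto simp: zs_def intro: mean2_pos)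
  have "(\<Sum>z\<leftarrow>zs. psi p (c * z)) = (\<Sum>i<n. \<Sum>j<n. psi p (c * mean2 q (x i) (x j)))"
    by (simp add: zs_def sum_list_map_concat o_def interv_sum_list_conv_sum_set_nat atLeast0LessThan)
  then show "(\<Sum>i<n. \<Sum>j<n. psi p (c * mean2 q (x i) (x j)))
    = (real n)\<^sup>2 * psi p (c * square_mean p q (map x [0..<n]))"
    using sum_list_psi_scaled[OF ne pos assms(3), of p] by (simp add: sq len power2_eq_square)
  show "0 < square_mean p q (map x [0..<n])"
    unfolding sq by (rule power_mean_pos[OF ne pos])
qed

lemmas square_mean_pos = psi_square_mean_scaled(2)[where c = 1, OF _ _ zero_less_one]

lemma psi_circ_mean_scaled:
  assumes "\<And>i. 0 < x i" "2 \<le> n" "0 < c"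
  shows "(\<Sum>i<n. \<Sum>j\<in>{Suc i..<n}. psi p (c * mean2 q (x i) (x j)))
    = real n * (real n - 1) / 2 * psi p (c * circ_mean p q (map x [0..<n]))"
    and "0 < circ_mean p q (map x [0..<n])"
proof -
  define zs where "zs = concat (map (\<lambda>i. map (\<lambda>j. mean2 q (x i) (x j)) [Suc i..<n]) [0..<n])"
  have circ: "circ_mean p q (map x [0..<n]) = power_mean p zs"
  proof -
    have "length (map x [0..<n]) \<noteq> 1" using assms by simp
    then show ?thesis
      unfolding mean_circ_def zs_def
      by (simp only: if_False)
        (intro arg_cong[where f = "power_mean p"] arg_cong[where f = concat] map_cong, auto)
  qed
  have "real (length zs) = (\<Sum>i<n. \<Sum>j\<in>{Suc i..<n}. 1)"
    by (simp add: zs_def length_concat o_def interv_sum_list_conv_sum_set_nat atLeast0LessThan)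
  \<comment> \<open>The number of pairs comes from \<open>sum_square_symmetric\<close> with the
    constant 1, which reads \<open>n * n = 2 * count + n\<close>.\<close>
  also have "\<dots> = real n * (real n - 1) / 2"
    using sum_square_symmetric[of "\<lambda>i j. 1" n] by (simp add: field_simps)
  finally have len: "real (length zs) = real n * (real n - 1) / 2" .
  moreover have "0 < real n * (real n - 1) / 2" using assms by simp
  ultimately have ne: "zs \<noteq> []" by auto
  have pos: "0 < z" if "z \<in> set zs" for z
    using that assms by (auto simp: zs_def intro: mean2_pos)
  have "(\<Sum>z\<leftarrow>zs. psi p (c * z)) = (\<Sum>i<n. \<Sum>j\<in>{Suc i..<n}. psi p (c * mean2 q (x i) (x j)))"
    by (simp add: zs_def sum_list_map_concat o_def interv_sum_list_conv_sum_set_nat atLeast0LessThan)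
  then show "(\<Sum>i<n. \<Sum>j\<in>{Suc i..<n}. psi p (c * mean2 q (x i) (x j)))
    = real n * (real n - 1) / 2 * psi p (c * circ_mean p q (map x [0..<n]))"
    using sum_list_psi_scaled[OF ne pos assms(3), of p] by (simp add: circ len)
  show "0 < circ_mean p q (map x [0..<n])"
    unfolding circ by (rule power_mean_pos[OF ne pos])
qed

lemma square_mean_singleton:
  assumes "0 < a"
  shows "square_mean p q [a] = a"
proof (rule psi_inject[of _ _ p])
  show "psi p (square_mean p q [a]) = psi p a"
    using psi_square_mean_scaled(1)[of "\<lambda>_. a" 1 1 p q] assms by (simp add: mean2_self)
  show "0 < square_mean p q [a]"
    using square_mean_pos[of "\<lambda>_. a" 1 p q] assms by simp
qed fact

lemma circ_mean_singleton: "circ_mean p q [a] = a"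
  by (simp add: mean_circ_def)

lemma circ_mean_pos:
  assumes "\<And>i. 0 < x i" "0 < n"
  shows "0 < circ_mean p q (map x [0..<n])"
proof (cases "n = 1")
  case True
  then show ?thesis using assms by (simp add: circ_mean_singleton)
next
  case False
  then show ?thesis using assms by (intro psi_circ_mean_scaled(2)[where c = 1]) auto
qed

text \<open>By \<open>psi_mean2_le\<close>, the average of \<open>psi p\<close> over the
  off-diagonal entries is at most its average over the diagonal ones, so adjoining the diagonal can
  only raise the mean.\<close>

lemma circ_mean_le_square_mean:
  assumes "q \<le> p" "\<And>i. 0 < x i" "0 < n"
  shows "circ_mean p q (map x [0..<n]) \<le> square_mean p q (map x [0..<n])"
proof (cases "n = 1")
  case True
  then show ?thesis using assms by (simp add: circ_mean_singleton square_mean_singleton)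
next
  case False
  then have n: "2 \<le> n" using assms by auto
  define g where "g i j = psi p (mean2 q (x i) (x j))" for i j
  define D where "D = (\<Sum>i<n. psi p (x i))"
  define T where "T = (\<Sum>i<n. \<Sum>j\<in>{Suc i..<n}. g i j)"
  define C where "C = psi p (circ_mean p q (map x [0..<n]))"
  have T: "2 * T = real n * (real n - 1) * C"
    using psi_circ_mean_scaled(1)[of x n 1 p q] assms(2) n by (simp add: T_def g_def C_def)
  have Tg: "(\<Sum>i<n. \<Sum>j<n. g i j) = 2 * T + D"
    unfolding T_def D_def
    by (subst sum_square_symmetric) (auto simp: g_def mean2_commute mean2_self assms)
  have "(\<Sum>i<n. \<Sum>j<n. g i j) \<le> (\<Sum>i<n. \<Sum>j<n. (psi p (x i) + psi p (x j)) / 2)"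
    unfolding g_def using assms by (intro sum_mono psi_mean2_le) auto
  also have "\<dots> = real n * D"
    by (simp add: D_def sum.distrib add_divide_distrib sum_distrib_left[symmetric] sum_divide_distrib[symmetric])
  finally have "(real n - 1) * (real n * C) \<le> (real n - 1) * D"
    using T Tg by (simp add: algebra_simps)
  then have "real n * C \<le> D" using n by simp
  then have "(real n)\<^sup>2 * C \<le> (\<Sum>i<n. \<Sum>j<n. g i j)"
    unfolding Tg T by (simp add: algebra_simps power2_eq_square)
  also have "\<dots> = (real n)\<^sup>2 * psi p (square_mean p q (map x [0..<n]))"
    using psi_square_mean_scaled(1)[of x n 1 p q] assms by (simp add: g_def)
  finally have "C \<le> psi p (square_mean p q (map x [0..<n]))"
    using n by simp
  then show ?thesis
    unfolding C_def using assms by (subst (asm) psi_le_iff) (auto intro: circ_mean_pos square_mean_pos)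
qed

text \<open>For each pair \<open>(j, l)\<close>, Jensen's inequality over triples
  \<open>(i, k, m)\<close> with weights \<open>M i / s * (a i j k * a i l m)\<close> is applied to
  the values \<open>mean2 q (x k) (x m) / M i\<close>. Summed over \<open>j\<close> and
  \<open>l\<close>, the left sides give zero and the right sides a positive multiple of
  \<open>psi p\<close> at \<open>S / s\<close> times the mean of the \<open>h j\<close>; hence that
  argument is at least 1.\<close>

lemma sum_square_mean_le:
  assumes "p \<le> 1" "q \<le> 1" "\<And>i. 0 < x i"
  shows "(\<Sum>i\<le>N. square_mean p q (map x [0..<Suc i]))
    \<le> (\<Sum>k\<le>N. x k) * square_mean p q (map (\<lambda>j. real (Suc N) / real (Suc j)) [0..<Suc N])"
proof -
  define M where "M i = square_mean p q (map x [0..<Suc i])" for i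
  define s where "s = (\<Sum>i\<le>N. M i)"
  define S where "S = (\<Sum>k\<le>N. x k)"
  \<comment> \<open>\<open>y j\<close> is \<open>N + 1\<close> times the average of
    \<open>x 0\<close>, ..., \<open>x j\<close>; bounding the partial sum by \<open>S\<close> yields
    \<open>S * h j\<close>.\<close>
  define y where "y j = real (Suc N) / real (Suc j) * (\<Sum>k\<le>j. x k)" for j
  define h where "h j = real (Suc N) / real (Suc j)" for j
  define T where "T = Sigma {..N} (\<lambda>i. {..i} \<times> {..i})"
  define a where "a = kedlaya N"
  have M: "0 < M i" for i
    unfolding M_def using assms by (intro square_mean_pos) auto
  have s: "0 < s" unfolding s_def using M by (intro sum_pos) auto
  have S: "0 < S" unfolding S_def using assms by (intro sum_pos) auto
  have h: "0 < h j" for j by (simp add: h_def)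
  have y_pos: "0 < y j" for j
    unfolding y_def using assms by (intro mult_pos_pos sum_pos) auto
  have y_le: "y j \<le> S * h j" if "j \<le> N" for j
  proof -
    have "(\<Sum>k\<le>j. x k) \<le> S"
      unfolding S_def using that assms by (intro sum_mono2) (auto intro: less_imp_le)
    then have "h j * (\<Sum>k\<le>j. x k) \<le> h j * S"
      using h[of j] by (intro mult_left_mono) auto
    then show ?thesis unfolding y_def h_def by (simp only: mult.commute)
  qed
  have sumT: "(\<Sum>(i, k, m)\<in>T. f i k m) = (\<Sum>i\<le>N. \<Sum>k\<le>i. \<Sum>m\<le>i. f i k m)" for f :: "nat \<Rightarrow> nat \<Rightarrow> nat \<Rightarrow> real"
    unfolding T_def by (simp add: sum.Sigma sum.cartesian_product case_prod_unfold)
  have prod: "(\<Sum>k\<in>A. \<Sum>m\<in>B. c * (u k * v m)) = c * ((\<Sum>k\<in>A. u k) * (\<Sum>m\<in>B. v m))"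
    for A B :: "nat set" and c :: real and u v
    by (subst sum_product) (simp only: sum_distrib_left)
  have y_eq: "(\<Sum>i\<le>N. \<Sum>k\<le>i. a i j k * x k) = y j" if "j \<le> N" for j
  proof -
    have "(\<Sum>i\<le>N. \<Sum>k\<le>i. a i j k * x k) = (\<Sum>i\<le>N. \<Sum>k\<le>j. a i j k * x k)"
      unfolding a_def by (intro sum.cong refl sum.mono_neutral_cong) (auto simp: kedlaya_eq_0)
    also have "\<dots> = (\<Sum>k\<le>j. (\<Sum>i\<le>N. a i j k) * x k)"
      by (subst sum.swap) (simp add: sum_distrib_right)
    also have "\<dots> = y j"
      using that by (simp add: a_def sum_kedlaya_fst y_def sum_distrib_left)
    finally show ?thesis .
  qed
  have key: "(\<Sum>(i, k, m)\<in>T. M i / s * (a i j k * a i l m) * psi p (1 / M i * mean2 q (x k) (x m)))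
      \<le> psi p (S / s * mean2 q (h j) (h l))" if "j \<le> N" "l \<le> N" for j l
  proof -
    have "(\<Sum>(i, k, m)\<in>T. M i / s * (a i j k * a i l m) * psi p (1 / M i * mean2 q (x k) (x m)))
      \<le> psi p (\<Sum>(i, k, m)\<in>T. M i / s * (a i j k * a i l m) * (1 / M i * mean2 q (x k) (x m)))"
    proof -
      \<comment> \<open>For fixed \<open>i\<close> both Kedlaya sums are 1, and the factors
        \<open>M i / s\<close> add up to 1.\<close>
      have "(\<Sum>(i, k, m)\<in>T. M i / s * (a i j k * a i l m)) = (\<Sum>i\<le>N. M i / s * ((\<Sum>k\<le>i. a i j k) * (\<Sum>m\<le>i. a i l m)))"
        unfolding sumT prod ..
      also have "\<dots> = (\<Sum>i\<le>N. M i / s)"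
        using that by (simp add: a_def sum_kedlaya_mean)
      also have "\<dots> = 1" using s by (simp add: s_def sum_divide_distrib[symmetric])
      finally have "(\<Sum>(i, k, m)\<in>T. M i / s * (a i j k * a i l m)) = 1" .
      then show ?thesis
        using psi_jensen[of p T "\<lambda>(i, k, m). M i / s * (a i j k * a i l m)"
            "\<lambda>(i, k, m). 1 / M i * mean2 q (x k) (x m)"] assms M s
        by (auto simp: case_prod_unfold T_def a_def kedlaya_nonneg mean2_pos less_imp_le)
    qed
    also have "\<dots> \<le> psi p (S / s * mean2 q (h j) (h l))"
    proof -
      \<comment> \<open>One Kedlaya factor sums to 1 and the other reproduces \<open>y j\<close>;
        \<open>y j\<close> and \<open>y l\<close> are the arguments that superadditivity
        produces.\<close>
      have 1: "(\<Sum>(i, k, m)\<in>T. a i j k * a i l m * x k) = y j"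
      proof -
        have "(\<Sum>(i, k, m)\<in>T. a i j k * a i l m * x k) = (\<Sum>i\<le>N. (\<Sum>k\<le>i. a i j k * x k) * (\<Sum>m\<le>i. a i l m))"
          unfolding sumT using prod[of 1 "\<lambda>k. a i j k * x k" "a i l" "{..i}" "{..i}" for i] by (simp add: mult_ac)
        then show ?thesis using that by (simp add: a_def sum_kedlaya_mean y_eq[unfolded a_def])
      qed
      have 2: "(\<Sum>(i, k, m)\<in>T. a i j k * a i l m * x m) = y l"
      proof -
        have "(\<Sum>(i, k, m)\<in>T. a i j k * a i l m * x m) = (\<Sum>i\<le>N. (\<Sum>k\<le>i. a i j k) * (\<Sum>m\<le>i. a i l m * x m))"
          unfolding sumT using prod[of 1 "a i j" "\<lambda>m. a i l m * x m" "{..i}" "{..i}" for i] by (simp add: mult_ac)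
        then show ?thesis using that by (simp add: a_def sum_kedlaya_mean y_eq[unfolded a_def])
      qed
      define r where "r = (\<Sum>(i, k, m)\<in>T. a i j k * a i l m * mean2 q (x k) (x m))"
      have "r \<le> mean2 q (y j) (y l)"
        using mean2_superadditive[of q T "\<lambda>(i, k, m). a i j k * a i l m" "\<lambda>(i, k, m). x k" "\<lambda>(i, k, m). x m"]
          1 2 assms y_pos
        by (auto simp: case_prod_unfold r_def T_def a_def kedlaya_nonneg)
      also have "\<dots> \<le> mean2 q (S * h j) (S * h l)"
        using that by (intro mean2_mono y_pos y_le)
      also have "\<dots> = S * mean2 q (h j) (h l)"
        by (intro mean2_mult h S)
      finally have "r / s \<le> S / s * mean2 q (h j) (h l)"
        using s by (simp add: divide_right_mono)
      \<comment> \<open>The factor \<open>M i\<close> in the weight cancels the normalisation of the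
        value.\<close>
      moreover have "(\<Sum>(i, k, m)\<in>T. M i / s * (a i j k * a i l m) * (1 / M i * mean2 q (x k) (x m))) = r / s"
        unfolding r_def sum_divide_distrib using M by (intro sum.cong refl) (auto simp: less_imp_neq[symmetric])
      moreover have "0 < r / s"
      proof -
        \<comment> \<open>The triple \<open>(0, 0, 0)\<close> already has coefficient 1, so
          \<open>r\<close> is positive and \<open>psi_le_iff\<close> applies.\<close>
        have "a 0 j 0 = 1" "a 0 l 0 = 1"
          using that by (simp_all add: a_def kedlaya_def)
        then have "0 < r"
          unfolding r_def using assms
          by (intro sum_pos2[of T "(0, 0, 0)"])
            (auto simp: T_def a_def kedlaya_nonneg mean2_pos less_imp_le)
        then show ?thesis using s by simp
      qed
      ultimately show ?thesis
        by (simp add: psi_le_iff)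
    qed
    finally show ?thesis .
  qed
  have "0 \<le> (\<Sum>j\<le>N. \<Sum>l\<le>N. psi p (S / s * mean2 q (h j) (h l)))"
  proof -
    \<comment> \<open>Divided by their mean \<open>M i\<close>, the entries have mean 1, and
      \<open>psi p 1 = 0\<close>.\<close>
    have zero: "(\<Sum>k\<le>i. \<Sum>m\<le>i. psi p (1 / M i * mean2 q (x k) (x m))) = 0" for i
      using psi_square_mean_scaled(1)[of x "Suc i" "1 / M i" p q] M[of i] assms
      by (simp add: lessThan_Suc_atMost M_def[symmetric] del: upt_Suc sum.lessThan_Suc)
    have "(\<Sum>j\<le>N. \<Sum>l\<le>N. \<Sum>(i, k, m)\<in>T. M i / s * (a i j k * a i l m) * psi p (1 / M i * mean2 q (x k) (x m)))
        = (\<Sum>(i, k, m)\<in>T. \<Sum>j\<le>N. \<Sum>l\<le>N. M i / s * (a i j k * a i l m) * psi p (1 / M i * mean2 q (x k) (x m)))"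
      by (simp add: sum.swap[where B = T] case_prod_unfold)
    also have "\<dots> = (\<Sum>(i, k, m)\<in>T. M i / s * ((\<Sum>j\<le>N. a i j k) * (\<Sum>l\<le>N. a i l m)) * psi p (1 / M i * mean2 q (x k) (x m)))"
      unfolding prod[symmetric] by (simp only: sum_distrib_right)
    \<comment> \<open>Both sums equal \<open>h i\<close>, independently of \<open>k\<close> and
      \<open>m\<close>, so the inner double sum is the one that vanishes by
      \<open>zero\<close>.\<close>
    also have "\<dots> = (\<Sum>i\<le>N. M i / s * (h i)\<^sup>2 * (\<Sum>k\<le>i. \<Sum>m\<le>i. psi p (1 / M i * mean2 q (x k) (x m))))"
      unfolding sumT
      by (simp add: a_def sum_kedlaya_snd h_def sum_distrib_left power2_eq_square mult.assoc del: of_nat_Suc)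
    also have "\<dots> = 0" unfolding zero by simp
    finally have "0 = (\<Sum>j\<le>N. \<Sum>l\<le>N. \<Sum>(i, k, m)\<in>T. M i / s * (a i j k * a i l m) * psi p (1 / M i * mean2 q (x k) (x m)))" ..
    also have "\<dots> \<le> (\<Sum>j\<le>N. \<Sum>l\<le>N. psi p (S / s * mean2 q (h j) (h l)))"
      by (intro sum_mono key) auto
    finally show ?thesis .
  qed
  also have "\<dots> = (real (Suc N))\<^sup>2 * psi p (S / s * square_mean p q (map h [0..<Suc N]))"
    using psi_square_mean_scaled(1)[of h "Suc N" "S / s" p q] h S s
    by (simp add: lessThan_Suc_atMost del: upt_Suc sum.lessThan_Suc)
  finally have "psi p 1 \<le> psi p (S / s * square_mean p q (map h [0..<Suc N]))"
    by (simp add: zero_le_mult_iff)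
  then have "1 \<le> S / s * square_mean p q (map h [0..<Suc N])"
    using S s square_mean_pos[of h "Suc N" p q] h by (subst (asm) psi_le_iff) auto
  then show ?thesis
    using s unfolding s_def[symmetric] S_def[symmetric] M_def[symmetric] h_def[symmetric]
    by (simp add: field_simps)
qed

section \<open>The integral over the unit square\<close>

abbreviation unit_square :: "(real \<times> real) set" where
  "unit_square \<equiv> {0<..1} \<times> {0<..1}"

text \<open>A line through the origin is a null hyperplane. This serves for the two axes and, later,
  for the diagonal.\<close>

lemma AE_lborel_prod_line:
  fixes a b :: real
  assumes "a \<noteq> 0 \<or> b \<noteq> 0"
  shows "AE z in lborel. a * fst z + b * snd z \<noteq> 0"
proof -
  have "(a, b) \<noteq> 0" using assms by (auto simp: zero_prod_def)
  then have "negligible {z. (a, b) \<bullet> z = 0}"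
    by (intro negligible_hyperplane) auto
  moreover have "{z. (a, b) \<bullet> z = 0} \<in> sets lborel"
    by (auto intro!: borel_closed closed_hyperplane)
  ultimately have "{z. (a, b) \<bullet> z = 0} \<in> null_sets lborel"
    by (auto simp: negligible_iff_null_sets null_sets_completion_iff)
  then show ?thesis
    by (rule AE_I') (auto simp: inner_prod_def)
qed

text \<open>Passes from the closed square in \<open>rho\<close> to the square without the axes, on
  which the reciprocals of both coordinates are at least 1.\<close>

lemma set_integral_unit_square:
  fixes f :: "real \<times> real \<Rightarrow> real"
  assumes [measurable]: "f \<in> borel_measurable borel"
  shows "set_integrable lborel ({0..1} \<times> {0..1}) f \<longleftrightarrow> set_integrable lborel unit_square f"
    and "(LINT z:{0..1} \<times> {0..1}|lborel. f z) = (LINT z:unit_square|lborel. f z)"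
proof -
  have [measurable]: "{0..1::real} \<times> {0..1::real} \<in> sets borel" "unit_square \<in> sets borel"
    by (auto intro!: borel_Times)
  have ae: "AE z in lborel. indicator ({0..1} \<times> {0..1}) z *\<^sub>R f z = indicator unit_square z *\<^sub>R f z"
    using AE_lborel_prod_line[of 1 0, simplified] AE_lborel_prod_line[of 0 1, simplified]
    by eventually_elim (auto simp: indicator_def)
  show "set_integrable lborel ({0..1} \<times> {0..1}) f \<longleftrightarrow> set_integrable lborel unit_square f"
    unfolding set_integrable_def by (intro integrable_cong_AE ae) measurable
  show "(LINT z:{0..1} \<times> {0..1}|lborel. f z) = (LINT z:unit_square|lborel. f z)"
    unfolding set_lebesgue_integral_def by (intro integral_cong_AE ae) measurable
qed

text \<open>Fubini for a product, after extending both factors by zero outside \<open>A\<close> and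
  \<open>B\<close>.\<close>

lemma set_integral_times:
  fixes u v :: "real \<Rightarrow> real"
  assumes "set_integrable lborel A u" "set_integrable lborel B v"
  shows "set_integrable lborel (A \<times> B) (\<lambda>(x, y). u x * v y)"
    and "(LINT z:A \<times> B|lborel. (\<lambda>(x, y). u x * v y) z) = (LINT x:A|lborel. u x) * (LINT y:B|lborel. v y)"
proof -
  define u' where "u' x = indicator A x *\<^sub>R u x" for x
  define v' where "v' x = indicator B x *\<^sub>R v x" for x
  define f where "f z = u' (fst z) * v' (snd z)" for z
  have u': "integrable lborel u'" and v': "integrable lborel v'"
    using assms by (simp_all add: set_integrable_def u'_def[abs_def] v'_def[abs_def])
  have [measurable]: "u' \<in> borel_measurable borel" "v' \<in> borel_measurable borel"
    using borel_measurable_integrable[OF u'] borel_measurable_integrable[OF v'] by simp_all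
  have f: "integrable (lborel \<Otimes>\<^sub>M lborel) f"
  proof (rule lborel_pair.Fubini_integrable)
    show "f \<in> borel_measurable (lborel \<Otimes>\<^sub>M lborel)"
      unfolding f_def by measurable
    show "integrable lborel (\<lambda>x. LINT y|lborel. norm (f (x, y)))"
      unfolding f_def using u' by (simp add: abs_mult)
    show "AE x in lborel. integrable lborel (\<lambda>y. f (x, y))"
      unfolding f_def using v' by simp
  qed
  have eq: "f = (\<lambda>z. indicator (A \<times> B) z *\<^sub>R (case z of (x, y) \<Rightarrow> u x * v y))"
    by (auto simp: fun_eq_iff f_def u'_def v'_def indicator_def)
  show "set_integrable lborel (A \<times> B) (\<lambda>(x, y). u x * v y)"
    using f unfolding lborel_prod set_integrable_def eq .
  have "integral\<^sup>L lborel f = (LINT x|lborel. LINT y|lborel. f (x, y))"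
    using lborel_pair.integral_fst'[OF f] by (simp add: lborel_prod)
  also have "\<dots> = integral\<^sup>L lborel u' * integral\<^sup>L lborel v'"
    by (simp add: f_def)
  finally show "(LINT z:A \<times> B|lborel. (\<lambda>(x, y). u x * v y) z) = (LINT x:A|lborel. u x) * (LINT y:B|lborel. v y)"
    by (simp add: set_lebesgue_integral_def eq u'_def[abs_def] v'_def[abs_def])
qed

section \<open>The integral of the generator and its relation to \<open>rho\<close>\<close>

definition psi_density :: "real \<Rightarrow> real \<Rightarrow> real \<times> real \<Rightarrow> real" where
  "psi_density p q z = psi p (mean2 q (1 / fst z) (1 / snd z))"

text \<open>Valued in \<open>ennreal\<close>, so that divergence is the value
  \<open>\<infinity>\<close> and comparison and Fatou arguments apply without integrability.\<close>

definition psi_integral :: "real \<Rightarrow> real \<Rightarrow> ennreal" where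
  "psi_integral p q = (\<integral>\<^sup>+z. ennreal (psi_density p q z) * indicator unit_square z \<partial>lborel)"

lemma measurable_psi_density [measurable]: "psi_density p q \<in> borel_measurable borel"
proof -
  have [measurable]: "psi p \<in> borel_measurable borel"
    by (cases "p = 0") (simp_all add: psi_def[abs_def])
  have [measurable]: "fst \<in> borel_measurable (borel :: (real \<times> real) measure)"
    "snd \<in> borel_measurable (borel :: (real \<times> real) measure)"
    by (auto intro!: borel_measurable_continuous_onI continuous_intros)
  have [measurable]: "(\<lambda>z. mean2 q (1 / fst z) (1 / snd z)) \<in> borel_measurable (borel :: (real \<times> real) measure)"
  proof (cases "q = 0")
    case True
    then have "(\<lambda>z. mean2 q (1 / fst z) (1 / snd z)) = (\<lambda>z::real \<times> real. sqrt (1 / fst z * (1 / snd z)))"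
      by (simp add: power_mean_def sqrt_def numeral_2_eq_2)
    then show ?thesis by simp
  next
    case False
    then have "(\<lambda>z. mean2 q (1 / fst z) (1 / snd z))
        = (\<lambda>z::real \<times> real. (((1 / fst z) powr q + (1 / snd z) powr q) / 2) powr (1 / q))"
      by (simp add: power_mean_def)
    then show ?thesis by simp
  qed
  show ?thesis
    unfolding psi_density_def[abs_def] by measurable
qed

lemma psi_density_nonneg:
  assumes "z \<in> unit_square"
  shows "0 \<le> psi_density p q z"
proof -
  have "1 = mean2 q 1 1" by (simp add: mean2_self)
  also have "\<dots> \<le> mean2 q (1 / fst z) (1 / snd z)"
    using assms by (intro mean2_mono) auto
  finally show ?thesis unfolding psi_density_def by (rule psi_nonneg)
qed

lemma psi_integral_eq:
  "psi_integral p q =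
     (if set_integrable lborel unit_square (psi_density p q)
      then ennreal (LINT z:unit_square|lborel. psi_density p q z) else \<infinity>)"
proof -
  define g where "g z = indicator unit_square z *\<^sub>R psi_density p q z" for z
  have [measurable]: "unit_square \<in> sets borel" by (auto intro!: borel_Times)
  have meas: "g \<in> borel_measurable lborel" unfolding g_def by measurable
  have nonneg: "0 \<le> g z" for z
    using psi_density_nonneg by (auto simp: g_def indicator_def)
  have J: "psi_integral p q = (\<integral>\<^sup>+z. ennreal (g z) \<partial>lborel)"
    unfolding psi_integral_def g_def by (intro nn_integral_cong) (auto simp: indicator_def)
  show ?thesis
  proof (cases "integrable lborel g")
    case True
    then show ?thesis
      using nn_integral_eq_integral[OF True] nonneg
      by (simp add: J set_integrable_def set_lebesgue_integral_def g_def[abs_def])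
  next
    case False
    then have "\<not> (\<integral>\<^sup>+z. ennreal (g z) \<partial>lborel) < \<infinity>"
      using integrableI_nonneg[OF meas] nonneg by blast
    then have "psi_integral p q = \<infinity>"
      by (simp add: J less_top[symmetric])
    then show ?thesis using False by (simp add: set_integrable_def g_def[abs_def])
  qed
qed

lemma set_integrable_const_unit_square: "set_integrable lborel unit_square (\<lambda>_. c::real)"
  and set_integral_const_unit_square: "(LINT z:unit_square|lborel. c) = c"
proof -
  have 1: "set_integrable lborel {0<..1::real} (\<lambda>_. d::real)" for d
    by (simp add: set_integrable_def)
  have 2: "(LINT x:{0<..1::real}|lborel. d) = d" for d :: real
    by (simp add: set_lebesgue_integral_def)
  show "set_integrable lborel unit_square (\<lambda>_. c)"
    using set_integral_times(1)[OF 1 1, of c 1] by (simp add: case_prod_unfold)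
  show "(LINT z:unit_square|lborel. c) = c"
    using set_integral_times(2)[OF 1 1, of c 1] by (simp add: case_prod_unfold 2)
qed

text \<open>The integrands in \<^const>\<open>rho\<close> are affine functions of \<^const>\<open>psi_density\<close> off the axes.\<close>

lemma psi_integral_affine:
  assumes "\<And>z. z \<in> unit_square \<Longrightarrow> f z = a + b * psi_density p q z" "b \<noteq> 0"
  shows "set_integrable lborel unit_square f \<Longrightarrow>
      psi_integral p q = ennreal (((LINT z:unit_square|lborel. f z) - a) / b)
      \<and> 0 \<le> ((LINT z:unit_square|lborel. f z) - a) / b"
    and "\<not> set_integrable lborel unit_square f \<Longrightarrow> psi_integral p q = \<infinity>"
proof -
  have sets: "unit_square \<in> sets lborel" by (auto intro!: borel_Times)
  have f: "set_integrable lborel unit_square f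
      \<longleftrightarrow> set_integrable lborel unit_square (\<lambda>z. a + b * psi_density p q z)"
    by (intro set_integrable_cong refl assms(1))
  have d: "set_integrable lborel unit_square (psi_density p q)
      \<longleftrightarrow> set_integrable lborel unit_square (\<lambda>z. (f z - a) / b)"
    using assms by (intro set_integrable_cong refl) auto
  have iff: "set_integrable lborel unit_square f \<longleftrightarrow> set_integrable lborel unit_square (psi_density p q)"
  proof
    assume "set_integrable lborel unit_square f"
    then show "set_integrable lborel unit_square (psi_density p q)"
      unfolding d by (intro set_integrable_divide set_integral_diff set_integrable_const_unit_square) 
  next
    assume "set_integrable lborel unit_square (psi_density p q)"
    then show "set_integrable lborel unit_square f"
      unfolding f by (intro set_integral_add set_integrable_mult_right set_integrable_const_unit_square)
  qed
  show "psi_integral p q = \<infinity>" if "\<not> set_integrable lborel unit_square f"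
    using that iff by (simp add: psi_integral_eq)
  show "psi_integral p q = ennreal (((LINT z:unit_square|lborel. f z) - a) / b)
      \<and> 0 \<le> ((LINT z:unit_square|lborel. f z) - a) / b" if int: "set_integrable lborel unit_square f"
  proof -
    have "(LINT z:unit_square|lborel. psi_density p q z) = (LINT z:unit_square|lborel. (f z - a) / b)"
      using assms by (intro set_lebesgue_integral_cong sets) auto
    also have "\<dots> = ((LINT z:unit_square|lborel. f z) - a) / b"
      using int by (simp add: set_integral_diff(2) set_integrable_const_unit_square set_integral_const_unit_square)
    finally have eq: "(LINT z:unit_square|lborel. psi_density p q z) = ((LINT z:unit_square|lborel. f z) - a) / b" .
    have "0 \<le> (LINT z:unit_square|lborel. psi_density p q z)"
      unfolding set_lebesgue_integral_def using psi_density_nonneg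
      by (intro Bochner_Integration.integral_nonneg) (auto simp: indicator_def)
    then show ?thesis
      using int iff by (simp add: psi_integral_eq eq)
  qed
qed

section \<open>Explicit integrals from antiderivatives\<close>

lemma set_integral_lborel_nonneg:
  fixes f :: "real \<Rightarrow> real"
  assumes "(f has_integral I) S" "\<And>x. x \<in> S \<Longrightarrow> 0 \<le> f x"
    and [measurable]: "f \<in> borel_measurable borel" "S \<in> sets borel"
  shows "set_integrable lborel S f" "(LINT x:S|lborel. f x) = I"
proof -
  have "f absolutely_integrable_on S"
    using assms(1,2) by (intro nonnegative_absolutely_integrable_1) auto
  then show *: "set_integrable lborel S f"
    unfolding set_integrable_def by (subst (asm) integrable_completion) measurable
  show "(LINT x:S|lborel. f x) = I"
    using set_borel_integral_eq_integral(2)[OF *] assms(1) by (simp add: integral_unique)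
qed

lemma set_integral_ln:
  "set_integrable lborel {0<..1} (ln :: real \<Rightarrow> real)" "(LINT x:{0<..1}|lborel. ln (x::real)) = -1"
proof -
  \<comment> \<open>An antiderivative of \<open>- ln\<close> that is continuous up to 0, with
    \<open>F 0 = 0\<close>.\<close>
  define F where "F x = x - x * ln x" for x :: real
  have "((\<lambda>x::real. inverse x * ln (inverse x)) \<longlongrightarrow> - 0) at_top"
  proof (rule Lim_transform_eventually)
    show "((\<lambda>x::real. - (ln x / x)) \<longlongrightarrow> - 0) at_top"
      by (intro tendsto_minus ln_x_over_x_tendsto_0)
    show "eventually (\<lambda>x::real. - (ln x / x) = inverse x * ln (inverse x)) at_top"
      using eventually_gt_at_top[of 0] by eventually_elim (simp add: ln_inverse divide_inverse mult.commute)
  qed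
  then have "((\<lambda>x::real. x * ln x) \<longlongrightarrow> 0) (at_right 0)"
    by (simp add: filterlim_at_right_to_top)
  then have "(F \<longlongrightarrow> 0 - 0) (at_right 0)"
    unfolding F_def by (intro tendsto_diff tendsto_ident_at)
  then have "continuous (at 0 within {0..1}) F"
    by (simp add: continuous_within F_def at_within_Icc_at_right)
  moreover have "continuous (at x within {0..1}) F" if "0 < x" for x
    unfolding F_def using that by (intro continuous_intros) auto
  ultimately have cont: "continuous_on {0..1} F"
    unfolding continuous_on_eq_continuous_within by (metis atLeastAtMost_iff less_le)
  have deriv: "(F has_vector_derivative - ln x) (at x)" if "x \<in> {0<..<1}" for x
  proof -
    have "(F has_real_derivative 1 - (1 * ln x + x * (1 / x))) (at x)"
      unfolding F_def using that by (auto intro!: derivative_eq_intros)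
    then show ?thesis
      using that by (simp add: has_real_derivative_iff_has_vector_derivative)
  qed
  have "((\<lambda>x. - ln x) has_integral (F 1 - F 0)) {0..1}"
    by (rule fundamental_theorem_of_calculus_interior[OF _ cont deriv]) simp_all
  then have "((\<lambda>x::real. - ln x) has_integral 1) {0..1}"
    by (simp add: F_def)
  \<comment> \<open>The intervals differ only in the point 0, where \<open>ln 0 = 0\<close> by
    convention, so even the exceptional set is empty.\<close>
  moreover have empty: "{x \<in> {0<..1} - {0..1}. - ln x \<noteq> 0} = ({} :: real set)"
    "{x \<in> {0..1} - {0<..1}. - ln x \<noteq> 0} = ({} :: real set)"
    by (auto simp: not_less)
  ultimately have "((\<lambda>x::real. - ln x) has_integral 1) {0<..1}"
    by (subst has_integral_spike_set_eq[of "{0<..1}" "{0..1}"]) (simp_all only: empty negligible_empty)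
  note * = set_integral_lborel_nonneg[OF this]
  have "set_integrable lborel {0<..1} (\<lambda>x::real. - ln x)" "(LINT x:{0<..1}|lborel. - ln (x::real)) = 1"
    by (rule *; simp)+
  then show "set_integrable lborel {0<..1} (ln :: real \<Rightarrow> real)" "(LINT x:{0<..1}|lborel. ln (x::real)) = -1"
    using set_integrable_mult_right[of "-1" lborel "{0<..1}" "\<lambda>x::real. - ln x"]
    by (simp_all add: set_lebesgue_integral_def)
qed

lemma psi_integral_zero_zero: "psi_integral 0 0 = 1"
proof -
  have 1: "set_integrable lborel {0<..1::real} (\<lambda>_. 1::real)" "(LINT x:{0<..1::real}|lborel. (1::real)) = 1"
    by (simp_all add: set_integrable_def set_lebesgue_integral_def)
  \<comment> \<open>This is \<open>ln x + ln y\<close>, written with factors 1 so that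
    \<open>set_integral_times\<close> applies to each summand.\<close>
  let ?f = "\<lambda>z. (case z of (x, y) \<Rightarrow> ln x * 1) + (case z of (x, y) \<Rightarrow> 1 * ln y) :: real"
  have f: "?f z = 0 + (-2) * psi_density 0 0 z" if "z \<in> unit_square" for z
  proof -
    have "mean2 0 (1 / fst z) (1 / snd z) = sqrt (1 / fst z * (1 / snd z))"
      by (simp add: power_mean_def sqrt_def numeral_2_eq_2)
    then show ?thesis
      using that by (auto simp: psi_density_def psi_def ln_sqrt ln_div ln_mult field_simps)
  qed
  note A = set_integral_times[OF set_integral_ln(1) 1(1)] and B = set_integral_times[OF 1(1) set_integral_ln(1)]
  have int: "set_integrable lborel unit_square ?f"
    by (rule set_integral_add(1)[OF A(1) B(1)])
  have "(LINT z:unit_square|lborel. ?f z) = -2"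
    unfolding set_integral_add(2)[OF A(1) B(1)] A(2) B(2) set_integral_ln(2) 1(2) by simp
  then show ?thesis
    using psi_integral_affine(1)[of ?f 0 "-2" 0 0, OF f _ int] by simp
qed

text \<open>Serves the formulas for \<open>p \<noteq> 0\<close>, with \<open>q\<close> zero or not:
  the \<open>p\<close>-th power of the mean is \<open>1 + p * psi_density p q z\<close>, so its
  integral \<open>I\<close> determines \<open>psi_integral\<close>, and
  \<open>I powr (1 / p)\<close> is the inverse image under \<open>psi p\<close>.\<close>

lemma psi_integral_powr:
  assumes "p \<noteq> 0" "\<And>z. z \<in> unit_square \<Longrightarrow> f z = mean2 q (1 / fst z) (1 / snd z) powr p"
  shows "set_integrable lborel unit_square f \<Longrightarrow>
      0 < (LINT z:unit_square|lborel. f z) \<and> 1 \<le> (LINT z:unit_square|lborel. f z) powr (1 / p) \<and>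
      psi_integral p q = ennreal (psi p ((LINT z:unit_square|lborel. f z) powr (1 / p)))"
    and "\<not> set_integrable lborel unit_square f \<Longrightarrow> psi_integral p q = \<infinity>"
proof -
  have f: "f z = 1 + p * psi_density p q z" if "z \<in> unit_square" for z
    using assms that by (simp add: psi_density_def psi_def)
  note affine = psi_integral_affine[of f 1 p, OF f assms(1)]
  show "psi_integral p q = \<infinity>" if "\<not> set_integrable lborel unit_square f"
    using affine(2) that by blast
  assume int: "set_integrable lborel unit_square f"
  define I where "I = (LINT z:unit_square|lborel. f z)"
  have I: "psi_integral p q = ennreal ((I - 1) / p)" "0 \<le> (I - 1) / p"
    using affine(1)[OF _ int] by (simp_all add: I_def)
  have fpos: "0 < f z" if "z \<in> unit_square" for z
  proof -
    have "0 < mean2 q (1 / fst z) (1 / snd z)" using that by (intro mean2_pos) auto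
    then show ?thesis using assms(2)[OF that] by simp
  qed
  let ?g = "\<lambda>z. indicator unit_square z *\<^sub>R f z"
  have nonneg: "0 \<le> ?g z" for z
    using fpos by (auto simp: indicator_def less_imp_le)
  \<comment> \<open>A zero integral of the strictly positive \<open>f\<close> would make the unit
    square a null set. Positivity of \<open>I\<close> is needed to undo the power
    \<open>1 / p\<close>.\<close>
  have "I \<noteq> 0"
  proof
    assume "I = 0"
    then have "AE z in lborel. ?g z = 0"
      using integral_nonneg_eq_0_iff_AE[of lborel ?g] int nonneg
      by (simp add: I_def set_lebesgue_integral_def set_integrable_def)
    then have "AE z in lborel. indicator unit_square z *\<^sub>R (1::real) = 0"
      by eventually_elim (use fpos in \<open>force simp: indicator_def split: if_splits\<close>)
    then have "(LINT z:unit_square|lborel. 1::real) = 0"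
      unfolding set_lebesgue_integral_def by (rule integral_eq_zero_AE)
    then show False by (simp add: set_integral_const_unit_square)
  qed
  moreover have "0 \<le> I"
    unfolding I_def set_lebesgue_integral_def using nonneg by (intro Bochner_Integration.integral_nonneg)
  ultimately have pos: "0 < I" by simp
  define R where "R = I powr (1 / p)"
  have psi_R: "psi p R = (I - 1) / p"
    using pos assms(1) by (simp add: R_def psi_def powr_powr)
  then have "psi p 1 \<le> psi p R" using I by simp
  then have "1 \<le> R" using pos by (subst (asm) psi_le_iff) (auto simp: R_def)
  then show "0 < I \<and> 1 \<le> I powr (1 / p) \<and> psi_integral p q = ennreal (psi p (I powr (1 / p)))"
    using pos psi_R I by (simp add: R_def)
qed

text \<open>Replaces the four formulas for \<open>rho\<close> by one description:
  \<open>psi p\<close> of \<open>rho\<close> is \<open>psi_integral\<close>, or both are infinite.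
  The bound \<open>1 \<le> R\<close> makes \<open>psi p R\<close> nonnegative, so the conversion to
  \<open>ennreal\<close> loses nothing.\<close>

lemma rho_cases:
  assumes "p \<le> 1"
  obtains "psi_integral p q = \<infinity>" "rho p q = \<infinity>"
  | R where "1 \<le> R" "psi_integral p q = ennreal (psi p R)" "rho p q = ereal R"
proof -
  let ?Q = "{0..1} \<times> {0..1} :: (real \<times> real) set"
  have [measurable]: "fst \<in> borel_measurable (borel :: (real \<times> real) measure)"
    "snd \<in> borel_measurable (borel :: (real \<times> real) measure)"
    by (auto intro!: borel_measurable_continuous_onI continuous_intros)
  have powr_recip: "(1 / x) powr r = x powr (- r)" for x r :: real
    by (cases "x = 0") (simp_all add: powr_minus_divide powr_divide)
  have mean: "mean2 q (1 / x) (1 / y) = ((x powr (-q) + y powr (-q)) / 2) powr (1 / q)" if "q \<noteq> 0" for x y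
    using that by (simp add: power_mean_def powr_recip)
  consider "p \<noteq> 0" "q \<noteq> 0" | "p = 0" "q \<noteq> 0" | "p \<noteq> 0" "q = 0" | "p = 0" "q = 0" by blast
  then show thesis
  proof cases
    case 1
    define f where "f = (\<lambda>(x::real, y::real). ((x powr (- q) + y powr (- q)) / 2) powr (p / q))"
    have [measurable]: "f \<in> borel_measurable borel"
      unfolding f_def case_prod_unfold by measurable
    have f: "f z = mean2 q (1 / fst z) (1 / snd z) powr p" if "z \<in> unit_square" for z
      using 1 by (simp add: f_def case_prod_unfold mean powr_powr)
    have rho: "rho p q = (if set_integrable lborel unit_square f
        then ereal ((LINT z:unit_square|lborel. f z) powr (1 / p)) else \<infinity>)"
      using 1 by (simp add: rho_def Let_def f_def[symmetric] set_integral_unit_square)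
    show thesis
      using psi_integral_powr[of p f q, OF 1(1) f] that rho by (cases "set_integrable lborel unit_square f") auto
  next
    case 2
    define f where "f = (\<lambda>(x::real, y::real). ln ((x powr (- q) + y powr (- q)) / 2))"
    have [measurable]: "f \<in> borel_measurable borel"
      unfolding f_def case_prod_unfold by measurable
    have f: "f z = 0 + q * psi_density p q z" if "z \<in> unit_square" for z
    proof -
      have "0 < (fst z powr (-q) + snd z powr (-q)) / 2"
        using that by (auto intro!: add_pos_pos)
      then show ?thesis
        using 2 by (simp add: f_def case_prod_unfold psi_density_def psi_def mean ln_powr)
    qed
    have rho: "rho p q = (if set_integrable lborel unit_square f
        then ereal (exp (1 / q * (LINT z:unit_square|lborel. f z))) else \<infinity>)"
      using 2 by (simp add: rho_def Let_def f_def[symmetric] set_integral_unit_square)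
    show thesis
    proof (cases "set_integrable lborel unit_square f")
      case True
      show ?thesis
        using psi_integral_affine(1)[of f 0 q p q, OF f 2(2) True] rho True 2
        by (intro that(2)[of "exp (1 / q * (LINT z:unit_square|lborel. f z))"]) (auto simp: psi_def)
    next
      case False
      then show ?thesis
        using psi_integral_affine(2)[of f 0 q p q, OF f 2(2) False] rho by (intro that(1)) auto
    qed
  next
    case 3
    define k where "k = (\<lambda>x::real. x powr (- p / 2))"
    \<comment> \<open>For \<open>p \<le> 1\<close> the exponent \<open>- p / 2\<close> exceeds -1,
      so the integral converges at 0.\<close>
    have "(k has_integral (1 powr (- p / 2 + 1) / (- p / 2 + 1))) {0..1}"
      unfolding k_def using assms by (intro has_integral_powr_from_0) auto
    then have k: "set_integrable lborel {0..1} k"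
      by (rule set_integral_lborel_nonneg) (auto simp: k_def)
    \<comment> \<open>For \<open>q = 0\<close> the mean is geometric, so its \<open>p\<close>-th
      power factors and the double integral is \<open>K * K\<close>.\<close>
    define f where "f = (\<lambda>(x, y). k x * k y)"
    have [measurable]: "k \<in> borel_measurable borel" by (simp add: k_def)
    have [measurable]: "f \<in> borel_measurable borel"
      unfolding f_def case_prod_unfold by measurable
    define K where "K = (LINT x:{0..1}|lborel. k x)"
    have K: "0 \<le> K"
      unfolding K_def set_lebesgue_integral_def
      by (intro Bochner_Integration.integral_nonneg) (auto simp: k_def)
    have int: "set_integrable lborel unit_square f" and I: "(LINT z:unit_square|lborel. f z) = K * K"
      using set_integral_times[OF k k] set_integral_unit_square[of f]
      by (simp_all add: K_def f_def)
    have f: "f z = mean2 q (1 / fst z) (1 / snd z) powr p" if "z \<in> unit_square" for z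
    proof -
      have "mean2 q (1 / fst z) (1 / snd z) = sqrt (1 / fst z * (1 / snd z))"
        using 3 by (simp add: power_mean_def sqrt_def numeral_2_eq_2)
      also have "\<dots> = (1 / fst z) powr (1 / 2) * (1 / snd z) powr (1 / 2)"
        using that by (auto simp: powr_half_sqrt real_sqrt_mult real_sqrt_divide)
      finally show ?thesis
        by (simp add: powr_recip f_def case_prod_unfold k_def powr_mult powr_powr)
    qed
    have *: "0 < K * K" "1 \<le> (K * K) powr (1 / p)" "psi_integral p q = ennreal (psi p ((K * K) powr (1 / p)))"
      using psi_integral_powr(1)[of p f q, OF 3(1) f int] by (simp_all add: I)
    have "(K * K) powr (1 / p) = K powr (2 / p)"
      using K by (simp add: powr_mult powr_add[symmetric])
    moreover have "rho p q = ereal (K powr (2 / p))"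
      using 3 k by (simp add: rho_def Let_def k_def K_def)
    ultimately show thesis using * that(2) by simp
  next
    case 4
    then show thesis
      using that(2)[of "exp 1"] psi_integral_zero_zero by (simp add: rho_def psi_def)
  qed
qed

section \<open>Riemann sums\<close>

text \<open>Open on the left, so that the first \<open>n\<close> cells partition
  \<open>{0<..1}\<close> and each contains its right end point, the reciprocal of the sample value
  \<open>n / (i + 1)\<close>.\<close>

definition cell :: "nat \<Rightarrow> nat \<Rightarrow> real set" where
  "cell n i = {real i / real n <.. real (Suc i) / real n}"

lemma cell_pos: "x \<in> cell n i \<Longrightarrow> 0 < n"
  by (cases n) (auto simp: cell_def)

lemma cell_unique:
  assumes "x \<in> cell n i" "x \<in> cell n j"
  shows "i = j"
proof -
  have "0 < n" using assms(1) by (rule cell_pos)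
  then have "real i < real (Suc j)" "real j < real (Suc i)"
    using assms by (auto simp: cell_def field_simps)
  then show ?thesis by linarith
qed

lemma cell_exists:
  assumes "0 < x" "x \<le> 1" "0 < n"
  shows "\<exists>i<n. x \<in> cell n i"
proof -
  \<comment> \<open>\<open>n * x\<close> lies in the interval from \<open>i\<close> (excluded) to
    \<open>i + 1\<close> (included) exactly when its ceiling is \<open>i + 1\<close>.\<close>
  define i where "i = nat (\<lceil>real n * x\<rceil> - 1)"
  have "0 < real n * x" "real n * x \<le> real n"
    using assms by (auto simp: mult_left_le)
  then have "0 < \<lceil>real n * x\<rceil>" "\<lceil>real n * x\<rceil> \<le> int n"
    by (simp_all add: ceiling_le_iff)
  moreover from this have "real i = \<lceil>real n * x\<rceil> - 1" by (simp add: i_def)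
  ultimately have "i < n" "real i < real n * x" "real n * x \<le> real (Suc i)"
    by linarith+
  then show ?thesis
    using assms by (intro exI[of _ i]) (auto simp: cell_def field_simps)
qed

lemma cell_subset: "i < n \<Longrightarrow> x \<in> cell n i \<Longrightarrow> x \<in> {0<..1}"
proof -
  assume i: "i < n" and x: "x \<in> cell n i"
  have "0 \<le> real i / real n" "real (Suc i) / real n \<le> 1" using i by (auto simp: divide_simps)
  moreover have "real i / real n < x" "x \<le> real (Suc i) / real n"
    using x by (simp_all add: cell_def del: of_nat_Suc)
  ultimately show "x \<in> {0<..1}" unfolding greaterThanAtMost_iff by linarith
qed

lemma emeasure_cell_times: "emeasure lborel (cell n i \<times> cell n j) = ennreal (1 / (real n)\<^sup>2)"
proof -
  have cell: "emeasure lborel (cell n i) = ennreal (1 / real n)" for i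
  proof -
    have "real i / real n \<le> real (Suc i) / real n" by (intro divide_right_mono) auto
    then have "emeasure lborel (cell n i) = ennreal (real (Suc i) / real n - real i / real n)"
      unfolding cell_def by (rule emeasure_lborel_Ioc)
    then show ?thesis by (simp add: diff_divide_distrib[symmetric])
  qed
  have "emeasure (lborel \<Otimes>\<^sub>M lborel) (cell n i \<times> cell n j) = emeasure lborel (cell n i) * emeasure lborel (cell n j)"
    by (intro lborel.emeasure_pair_measure_Times) (auto simp: cell_def)
  then show ?thesis
    by (simp add: lborel_prod cell ennreal_mult[symmetric] power2_eq_square)
qed

section \<open>Step functions on the grid, lower sums and their limit\<close>

definition step_function :: "nat \<Rightarrow> (nat \<Rightarrow> nat \<Rightarrow> real) \<Rightarrow> real \<times> real \<Rightarrow> ennreal" where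
  "step_function n c z = (\<Sum>i<n. \<Sum>j<n. ennreal (c i j) * indicator (cell n i \<times> cell n j) z)"

lemma measurable_cell_times [measurable]: "cell n i \<times> cell n j \<in> sets borel"
  by (auto simp: cell_def intro!: borel_Times)

lemma measurable_step_function [measurable]: "step_function n c \<in> borel_measurable borel"
  unfolding step_function_def[abs_def] by measurable

lemma nn_integral_step_function:
  assumes "\<And>i j. 0 \<le> c i j"
  shows "(\<integral>\<^sup>+z. step_function n c z \<partial>lborel) = ennreal ((\<Sum>i<n. \<Sum>j<n. c i j) / (real n)\<^sup>2)"
proof -
  have "(\<integral>\<^sup>+z. step_function n c z \<partial>lborel) = (\<Sum>i<n. \<Sum>j<n. ennreal (c i j) * ennreal (1 / (real n)\<^sup>2))"
    unfolding step_function_def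
  proof (subst nn_integral_sum, measurable, intro sum.cong refl, subst nn_integral_sum, measurable, intro sum.cong refl)
    fix i j
    show "(\<integral>\<^sup>+z. ennreal (c i j) * indicator (cell n i \<times> cell n j) z \<partial>lborel) = ennreal (c i j) * ennreal (1 / (real n)\<^sup>2)"
      by (subst nn_integral_cmult_indicator) (simp_all add: emeasure_cell_times)
  qed
  also have "\<dots> = ennreal (\<Sum>i<n. \<Sum>j<n. c i j * (1 / (real n)\<^sup>2))"
    using assms by (simp add: ennreal_mult'[symmetric] sum_nonneg)
  finally show ?thesis by (simp add: sum_divide_distrib)
qed

lemma step_function_eq:
  assumes "i < n" "j < n" "x \<in> cell n i" "y \<in> cell n j"
  shows "step_function n c (x, y) = ennreal (c i j)"
proof -
  have x: "x \<in> cell n k \<longleftrightarrow> k = i" and y: "y \<in> cell n k \<longleftrightarrow> k = j" for k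
    using assms cell_unique by blast+
  have "step_function n c (x, y) = (\<Sum>k<n. \<Sum>l<n. if k = i then if l = j then ennreal (c i j) else 0 else 0)"
    unfolding step_function_def by (intro sum.cong refl) (auto simp: x y)
  also have "\<dots> = (\<Sum>k<n. if k = i then \<Sum>l<n. if l = j then ennreal (c i j) else 0 else 0)"
    by (intro sum.cong) auto
  also have "\<dots> = ennreal (c i j)"
    using assms by simp
  finally show ?thesis .
qed

lemma step_function_outside:
  assumes "z \<notin> unit_square"
  shows "step_function n c z = 0"
  unfolding step_function_def using assms cell_subset
  by (intro sum.neutral ballI) (auto simp: indicator_def)

text \<open>The value of \<open>psi_density\<close> at the upper right corner of a cell, where the
  reciprocals are smallest; averages of these values are lower Riemann sums.\<close>

definition grid :: "real \<Rightarrow> real \<Rightarrow> nat \<Rightarrow> nat \<Rightarrow> nat \<Rightarrow> real" where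
  "grid p q n i j = psi p (mean2 q (real n / real (Suc i)) (real n / real (Suc j)))"

lemma grid_le_psi_density:
  assumes "x \<in> cell n i" "y \<in> cell n j"
  shows "grid p q n i j \<le> psi_density p q (x, y)"
proof -
  have n: "0 < n" using assms(1) by (rule cell_pos)
  have bound: "0 < real n / real (Suc i)" "real n / real (Suc i) \<le> 1 / x" if "x \<in> cell n i" for x i
  proof -
    have "0 \<le> real i / real n" by simp
    moreover have "real i / real n < x" "x \<le> real (Suc i) / real n"
      using that by (simp_all add: cell_def del: of_nat_Suc)
    ultimately have "0 < x" "x \<le> real (Suc i) / real n" by linarith+
    then show "0 < real n / real (Suc i)" "real n / real (Suc i) \<le> 1 / x" using n by (auto simp: field_simps)
  qed
  have "mean2 q (real n / real (Suc i)) (real n / real (Suc j)) \<le> mean2 q (1 / x) (1 / y)"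
    using assms by (intro mean2_mono bound)
  moreover have "0 < mean2 q (real n / real (Suc i)) (real n / real (Suc j))"
    using assms by (intro mean2_pos bound)
  ultimately show ?thesis
    unfolding grid_def psi_density_def fst_conv snd_conv by (subst psi_le_iff) linarith+
qed

lemma grid_nonneg:
  assumes "i < n" "j < n"
  shows "0 \<le> grid p q n i j"
proof -
  have "1 = mean2 q 1 1" by (simp add: mean2_self)
  also have "\<dots> \<le> mean2 q (real n / real (Suc i)) (real n / real (Suc j))"
    using assms by (intro mean2_mono) auto
  finally show ?thesis unfolding grid_def by (rule psi_nonneg)
qed

lemma grid_average_le:
  "ennreal ((\<Sum>i<n. \<Sum>j<n. grid p q n i j) / (real n)\<^sup>2) \<le> psi_integral p q"
proof -
  \<comment> \<open>Set to zero outside the index range, because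
    \<open>nn_integral_step_function\<close> asks for nonnegative coefficients at all
    indices.\<close>
  let ?c = "\<lambda>i j. if i < n \<and> j < n then grid p q n i j else 0"
  have "ennreal ((\<Sum>i<n. \<Sum>j<n. grid p q n i j) / (real n)\<^sup>2) = ennreal ((\<Sum>i<n. \<Sum>j<n. ?c i j) / (real n)\<^sup>2)"
    by simp
  also have "\<dots> = (\<integral>\<^sup>+z. step_function n ?c z \<partial>lborel)"
    by (intro nn_integral_step_function[symmetric]) (auto simp: grid_nonneg)
  also have "\<dots> \<le> psi_integral p q"
    unfolding psi_integral_def
  proof (intro nn_integral_mono)
    fix z :: "real \<times> real"
    obtain x y where z: "z = (x, y)" by fastforce
    show "step_function n ?c z \<le> ennreal (psi_density p q z) * indicator unit_square z"
    proof (cases "z \<in> unit_square \<and> 0 < n")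
      case True
      then obtain i j where ij: "i < n" "j < n" "x \<in> cell n i" "y \<in> cell n j"
        using cell_exists[of x n] cell_exists[of y n] z by auto
      then show ?thesis
        using True step_function_eq[OF ij, of ?c] grid_le_psi_density[OF ij(3,4)]
        by (auto simp: z intro: ennreal_leI)
    next
      case False
      then have "step_function n ?c z = 0"
        using step_function_outside by (cases "n = 0") (auto simp: step_function_def)
      then show ?thesis by simp
    qed
  qed
  finally show ?thesis .
qed

text \<open>The right end point of the cell containing \<open>x\<close> is within
  \<open>1 / n\<close> of \<open>x\<close>; the rest is continuity of the mean and of
  \<open>psi p\<close>.\<close>

lemma tendsto_grid:
  assumes "0 < x" "0 < y"
    and "\<And>n. 0 < n \<Longrightarrow> x \<in> cell n (i n)" "\<And>n. 0 < n \<Longrightarrow> y \<in> cell n (j n)"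
  shows "(\<lambda>n. grid p q n (i n) (j n)) \<longlonglongrightarrow> psi_density p q (x, y)"
proof -
  have lim: "(\<lambda>n. real n / real (Suc (i n))) \<longlonglongrightarrow> 1 / x"
    if "0 < x" "\<And>n. 0 < n \<Longrightarrow> x \<in> cell n (i n)" for x i
  proof -
    have "(\<lambda>n. real (Suc (i n)) / real n) \<longlonglongrightarrow> x"
    proof (rule real_tendsto_sandwich)
      show "(\<lambda>n. x) \<longlonglongrightarrow> x" by simp
      have "(\<lambda>n. x + 1 / real n) \<longlonglongrightarrow> x + 0"
        by (intro tendsto_add tendsto_const lim_1_over_n)
      then show "(\<lambda>n. x + 1 / real n) \<longlonglongrightarrow> x" by simp
      show "eventually (\<lambda>n. x \<le> real (Suc (i n)) / real n) sequentially"
        using eventually_gt_at_top[of 0] by eventually_elim (use that in \<open>auto simp: cell_def\<close>)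
      show "eventually (\<lambda>n. real (Suc (i n)) / real n \<le> x + 1 / real n) sequentially"
        using eventually_gt_at_top[of 0]
      proof eventually_elim
        case (elim n)
        have "real (i n) / real n < x" using that(2)[OF elim] by (simp add: cell_def)
        then show ?case by (simp add: add_divide_distrib)
      qed
    qed
    then have "(\<lambda>n. 1 / (real (Suc (i n)) / real n)) \<longlonglongrightarrow> 1 / x"
      using that(1) by (intro tendsto_divide tendsto_const) auto
    then show ?thesis by simp
  qed
  let ?a = "\<lambda>n. real n / real (Suc (i n))" and ?b = "\<lambda>n. real n / real (Suc (j n))"
  have a: "?a \<longlonglongrightarrow> 1 / x" and b: "?b \<longlonglongrightarrow> 1 / y"
    using assms by (auto intro!: lim simp del: of_nat_Suc)
  have m: "(\<lambda>n. mean2 q (?a n) (?b n)) \<longlonglongrightarrow> mean2 q (1 / x) (1 / y)"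
  proof (cases "q = 0")
    case True
    have "(\<lambda>n. sqrt (?a n * ?b n)) \<longlonglongrightarrow> sqrt (1 / x * (1 / y))"
      by (intro tendsto_intros a b)
    then show ?thesis using True by (simp add: power_mean_def sqrt_def numeral_2_eq_2)
  next
    case False
    have "(1 / x) powr q + (1 / y) powr q \<noteq> 0"
      using assms by (simp add: add_nonneg_eq_0_iff)
    then have "(\<lambda>n. (((?a n) powr q + (?b n) powr q) / 2) powr (1 / q))
        \<longlonglongrightarrow> (((1 / x) powr q + (1 / y) powr q) / 2) powr (1 / q)"
      using assms by (intro tendsto_powr tendsto_divide tendsto_add a b tendsto_const) auto
    then show ?thesis using False by (simp add: power_mean_def)
  qed
  have "0 < mean2 q (1 / x) (1 / y)" using assms by (intro mean2_pos) auto
  then have "isCont (psi p) (mean2 q (1 / x) (1 / y))"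
    by (rule DERIV_isCont[OF DERIV_psi])
  then show ?thesis
    unfolding grid_def psi_density_def fst_conv snd_conv by (rule isCont_tendsto_compose[OF _ m])
qed

text \<open>The diagonal is left out so that the bound serves both mixed means.\<close>

lemma psi_integral_le_liminf:
  "psi_integral p q
    \<le> liminf (\<lambda>n. ennreal ((\<Sum>i<n. \<Sum>j<n. if i = j then 0 else grid p q n i j) / (real n)\<^sup>2))"
proof -
  let ?c = "\<lambda>n i j. if i < n \<and> j < n \<and> i \<noteq> j then grid p q n i j else 0"
  have "psi_integral p q \<le> (\<integral>\<^sup>+z. liminf (\<lambda>n. step_function n (?c n) z) \<partial>lborel)"
    unfolding psi_integral_def
  proof (rule nn_integral_mono_AE)
    have "AE z in lborel. fst z \<noteq> (snd z :: real)"
      using AE_lborel_prod_line[of 1 "-1"] by simp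
    then show "AE z in lborel. ennreal (psi_density p q z) * indicator unit_square z
        \<le> liminf (\<lambda>n. step_function n (?c n) z)"
    proof eventually_elim
      case (elim z)
      show ?case
      proof (cases "z \<in> unit_square")
        case True
        obtain x y where z: "z = (x, y)" by fastforce
        have xy: "0 < x" "x \<le> 1" "0 < y" "y \<le> 1" "x \<noteq> y" using True elim z by auto
        obtain i where i: "\<And>n. 0 < n \<Longrightarrow> i n < n" "\<And>n. 0 < n \<Longrightarrow> x \<in> cell n (i n)"
          using cell_exists[OF xy(1,2)] by metis
        obtain j where j: "\<And>n. 0 < n \<Longrightarrow> j n < n" "\<And>n. 0 < n \<Longrightarrow> y \<in> cell n (j n)"
          using cell_exists[OF xy(3,4)] by metis
        \<comment> \<open>Two points of one cell are less than \<open>1 / n\<close> apart, so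
          distinct coordinates eventually lie in distinct cells and the omitted diagonal is not
          seen.\<close>
        have "eventually (\<lambda>n. 1 / real n < \<bar>x - y\<bar>) sequentially"
          using lim_1_over_n xy(5) by (intro order_tendstoD(2)) auto
        then have ev: "eventually (\<lambda>n. ennreal (grid p q n (i n) (j n)) = step_function n (?c n) z) sequentially"
          using eventually_gt_at_top[of 0]
        proof eventually_elim
          case (elim n)
          have "i n \<noteq> j n"
          proof
            assume "i n = j n"
            then have "x \<in> cell n (i n)" "y \<in> cell n (i n)"
              using i(2)[of n] j(2)[of n] elim by simp_all
            then have "\<bar>x - y\<bar> < 1 / real n" by (auto simp: cell_def add_divide_distrib)
            then show False using elim by simp
          qed
          then show ?case
            using i j elim by (simp add: z step_function_eq[of "i n" n "j n"])
        qed
        have "(\<lambda>n. ennreal (grid p q n (i n) (j n))) \<longlonglongrightarrow> ennreal (psi_density p q z)"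
          unfolding z using xy i j by (intro tendsto_ennrealI tendsto_grid) auto
        then have "(\<lambda>n. step_function n (?c n) z) \<longlonglongrightarrow> ennreal (psi_density p q z)"
          by (rule Lim_transform_eventually[OF _ ev])
        then show ?thesis
          using True by (simp add: lim_imp_Liminf)
      qed simp
    qed
  qed
  \<comment> \<open>Fatou's lemma, which also covers a divergent integral.\<close>
  also have "\<dots> \<le> liminf (\<lambda>n. \<integral>\<^sup>+z. step_function n (?c n) z \<partial>lborel)"
    by (rule nn_integral_liminf) simp
  also have "(\<lambda>n. \<integral>\<^sup>+z. step_function n (?c n) z \<partial>lborel)
      = (\<lambda>n. ennreal ((\<Sum>i<n. \<Sum>j<n. if i = j then 0 else grid p q n i j) / (real n)\<^sup>2))"
  proof
    fix n
    have "(\<integral>\<^sup>+z. step_function n (?c n) z \<partial>lborel) = ennreal ((\<Sum>i<n. \<Sum>j<n. ?c n i j) / (real n)\<^sup>2)"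
      by (intro nn_integral_step_function) (auto simp: grid_nonneg)
    also have "(\<Sum>i<n. \<Sum>j<n. ?c n i j) = (\<Sum>i<n. \<Sum>j<n. if i = j then 0 else grid p q n i j)"
      by (intro sum.cong) auto
    finally show "(\<integral>\<^sup>+z. step_function n (?c n) z \<partial>lborel)
      = ennreal ((\<Sum>i<n. \<Sum>j<n. if i = j then 0 else grid p q n i j) / (real n)\<^sup>2)" .
  qed
  finally show ?thesis .
qed

section \<open>Hardy constants\<close>

text \<open>The upper estimate for partial sums passes to the series. For the lower one, each term
  of the mean series of the harmonic sequence is eventually at least \<open>K / (n + 1)\<close>, so
  a cut-off late enough lets the divergence of the harmonic series exclude every constant below
  \<open>K\<close>.\<close>

lemma hardy_const_eqI:
  fixes M :: "real list \<Rightarrow> real" and \<rho> :: ereal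
  assumes pos: "\<And>x n. (\<And>i. 0 < x i) \<Longrightarrow> 0 < M (map x [0..<Suc n])" and "0 < \<rho>"
    and upper: "\<And>x N. (\<And>i. 0 < x i) \<Longrightarrow>
      ereal (\<Sum>n\<le>N. M (map x [0..<Suc n])) \<le> \<rho> * ereal (\<Sum>k\<le>N. x k)"
    and lower: "\<And>K. 0 < K \<Longrightarrow> ereal K < \<rho> \<Longrightarrow>
      eventually (\<lambda>n. K \<le> real (Suc n) * M (map (\<lambda>k. 1 / real (Suc k)) [0..<Suc n])) sequentially"
  shows "hardy_const M = \<rho>"
  unfolding hardy_const_def
proof (rule Least_equality)
  show "\<forall>x. (\<forall>n. 0 < x n) \<longrightarrow> summable x \<longrightarrow>
    (\<Sum>n. ereal (M (map x [0..<Suc n]))) \<le> \<rho> * ereal (\<Sum>n. x n)"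
  proof (intro allI impI)
    fix x :: "nat \<Rightarrow> real"
    assume x: "\<forall>n. 0 < x n" "summable x"
    show "(\<Sum>n. ereal (M (map x [0..<Suc n]))) \<le> \<rho> * ereal (\<Sum>n. x n)"
    proof (rule suminf_bound, rule allI)
      fix m
      show "0 \<le> ereal (M (map x [0..<Suc m]))"
        using pos[of x m] x by (simp add: less_imp_le del: upt_Suc)
      have S: "0 \<le> (\<Sum>n. x n)" using x by (intro suminf_nonneg) (auto intro: less_imp_le)
      show "(\<Sum>n<m. ereal (M (map x [0..<Suc n]))) \<le> \<rho> * ereal (\<Sum>n. x n)"
      proof (cases m)
        case 0
        have "0 \<le> \<rho> * ereal (\<Sum>n. x n)"
          using S assms(2) by (intro ereal_0_le_mult) auto
        then show ?thesis by (simp only: 0 lessThan_0 sum.empty)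
      next
        case (Suc N)
        have "(\<Sum>n<m. ereal (M (map x [0..<Suc n]))) = ereal (\<Sum>n\<le>N. M (map x [0..<Suc n]))"
          by (simp add: Suc lessThan_Suc_atMost del: upt_Suc sum.lessThan_Suc)
        also have "\<dots> \<le> \<rho> * ereal (\<Sum>k\<le>N. x k)"
          using x by (intro upper) auto
        also have "\<dots> \<le> \<rho> * ereal (\<Sum>n. x n)"
          using sum_le_suminf[OF x(2), of "{..N}"] x assms(2)
          by (intro ereal_mult_left_mono) (simp_all add: less_imp_le)
        finally show ?thesis .
      qed
    qed
  qed
next
  fix C
  assume C: "\<forall>x. (\<forall>n. 0 < x n) \<longrightarrow> summable x \<longrightarrow>
    (\<Sum>n. ereal (M (map x [0..<Suc n]))) \<le> C * ereal (\<Sum>n. x n)"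
  show "\<rho> \<le> C"
  proof (rule ccontr)
    assume "\<not> \<rho> \<le> C"
    then have "max 0 C < \<rho>" using assms(2) by auto
    then obtain K where K: "max 0 C < ereal K" "ereal K < \<rho>" using ereal_dense2 by blast
    \<comment> \<open>A positive real strictly between \<open>C\<close> and \<open>K\<close>
      replaces \<open>C\<close>, which may be infinite or negative.\<close>
    obtain c where c: "max 0 C < ereal c" "ereal c < ereal K" using ereal_dense2[OF K(1)] by blast
    have c0: "0 < c" "C \<le> ereal c" "c < K" "0 < K" using c K by auto
    obtain n0 where n0: "\<And>n. n0 \<le> n \<Longrightarrow> K \<le> real (Suc n) * M (map (\<lambda>k. 1 / real (Suc k)) [0..<Suc n])"
      using lower[OF c0(4) K(2)] unfolding eventually_sequentially by auto
    have bound: "(K - c) * harm (Suc N) \<le> 2 * c + K * harm n0" for N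
    proof -
      define u where "u k = (if k \<le> N then 1 / real (Suc k) else 0)" for k
      \<comment> \<open>Beyond the cut-off a geometric tail keeps the sequence positive and
        summable; it adds at most 2 to the sum, whatever \<open>N\<close> is.\<close>
      define x where "x k = (if k \<le> N then 1 / real (Suc k) else (1 / 2) ^ k)" for k
      have x: "0 < x k" for k by (simp add: x_def)
      have "u sums (\<Sum>k | k \<le> N. 1 / real (Suc k))"
        unfolding u_def by (rule sums_If_finite) simp
      also have "(\<Sum>k | k \<le> N. 1 / real (Suc k)) = harm (Suc N)"
        unfolding harm_altdef lessThan_Suc_atMost by (intro sum.cong) (auto simp: inverse_eq_divide)
      finally have "(\<lambda>k. u k + (1 / 2) ^ k) sums (harm (Suc N) + 1 / (1 - 1 / 2))"
        by (intro sums_add geometric_sums) auto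
      then have sums: "(\<lambda>k. u k + (1 / 2) ^ k) sums (harm (Suc N) + 2)" by simp
      have le: "x k \<le> u k + (1 / 2) ^ k" for k by (simp add: x_def u_def)
      have summable: "summable x"
        by (rule summable_comparison_test'[OF sums_summable[OF sums], of 0])
          (use le x in \<open>auto simp: less_imp_le\<close>)
      have S: "(\<Sum>k. x k) \<le> harm (Suc N) + 2"
        using suminf_le[OF le summable sums_summable[OF sums]] sums_unique[OF sums] by simp
      have S0: "0 \<le> (\<Sum>k. x k)" using x summable by (intro suminf_nonneg) (auto intro: less_imp_le)
      define m where "m n = M (map x [0..<Suc n])" for n
      have m: "0 < m n" for n unfolding m_def using x by (intro pos)
      have "ereal (\<Sum>n\<le>N. m n) = (\<Sum>n<Suc N. ereal (m n))"
        by (simp add: lessThan_Suc_atMost del: sum.lessThan_Suc)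
      also have "\<dots> \<le> (\<Sum>n. ereal (m n))"
        using m by (intro suminf_upper) (simp add: less_imp_le)
      also have "\<dots> \<le> C * ereal (\<Sum>k. x k)"
        unfolding m_def using C x summable by blast
      also have "\<dots> \<le> ereal c * ereal (\<Sum>k. x k)"
        using c0 S0 by (intro ereal_mult_right_mono) auto
      also have "\<dots> \<le> ereal (c * (harm (Suc N) + 2))"
        using c0 S by (simp add: mult_left_mono)
      finally have up: "(\<Sum>n\<le>N. m n) \<le> c * (harm (Suc N) + 2)" by simp
      \<comment> \<open>For the first \<open>n0\<close> terms only positivity of the mean is known,
        so the bound there is reduced to zero; the loss is at most
        \<open>K * harm n0\<close>.\<close>
      have termwise: "K / real (Suc n) - (if n < n0 then K / real (Suc n) else 0) \<le> m n" if "n \<le> N" for n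
      proof (cases "n < n0")
        case True
        then show ?thesis using m[of n] by simp
      next
        case False
        have "map x [0..<Suc n] = map (\<lambda>k. 1 / real (Suc k)) [0..<Suc n]"
          using that by (intro map_cong) (auto simp: x_def)
        then have "K \<le> real (Suc n) * m n"
          unfolding m_def using n0[of n] False by (simp only: not_less)
        then show ?thesis using False by (simp add: pos_divide_le_eq mult.commute del: of_nat_Suc)
      qed
      have "(\<Sum>n\<le>N. if n < n0 then K / real (Suc n) else 0) \<le> (\<Sum>n<n0. K / real (Suc n))"
        unfolding sum.inter_filter[OF finite_atMost, symmetric]
        using c0 by (intro sum_mono2) auto
      also have "\<dots> = K * harm n0"
        by (simp add: harm_altdef sum_distrib_left divide_inverse)
      finally have head: "(\<Sum>n\<le>N. if n < n0 then K / real (Suc n) else 0) \<le> K * harm n0" .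
      have "K * harm (Suc N) = (\<Sum>n\<le>N. K / real (Suc n))"
        by (simp add: harm_altdef sum_distrib_left divide_inverse lessThan_Suc_atMost del: sum.lessThan_Suc)
      also have "\<dots> - (\<Sum>n\<le>N. if n < n0 then K / real (Suc n) else 0) \<le> (\<Sum>n\<le>N. m n)"
        unfolding sum_subtractf[symmetric] by (intro sum_mono termwise) auto
      finally show ?thesis using up head by (simp add: algebra_simps)
    qed
    have "eventually (\<lambda>n. (2 * c + K * harm n0) / (K - c) < harm n) sequentially"
      using harm_at_top by (simp add: filterlim_at_top_dense)
    then have "eventually (\<lambda>n. (2 * c + K * harm n0) / (K - c) < harm (Suc n)) sequentially"
      by (rule eventually_sequentially_Suc[THEN iffD2])
    then obtain N where "(2 * c + K * harm n0) / (K - c) < harm (Suc N)"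
      by (auto simp: eventually_sequentially)
    then have "2 * c + K * harm n0 < (K - c) * harm (Suc N)"
      using c0 by (simp add: pos_divide_less_eq mult.commute)
    then show False using bound[of N] by simp
  qed
qed

section \<open>Comparison of both mixed means with \<open>rho\<close>\<close>

lemma square_mean_le_rho:
  assumes "p \<le> 1"
  shows "ereal (square_mean p q (map (\<lambda>j. real (Suc N) / real (Suc j)) [0..<Suc N])) \<le> rho p q"
proof -
  define s where "s = square_mean p q (map (\<lambda>j. real (Suc N) / real (Suc j)) [0..<Suc N])"
  have s: "0 < s" unfolding s_def by (intro square_mean_pos) auto
  \<comment> \<open>At the points \<open>(N + 1) / (j + 1)\<close> the generator sum of the square
    mean is exactly the grid sum, which lies below the integral.\<close>
  have eq: "(\<Sum>i<Suc N. \<Sum>j<Suc N. grid p q (Suc N) i j) = (real (Suc N))\<^sup>2 * psi p s"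
    using psi_square_mean_scaled(1)[of "\<lambda>j. real (Suc N) / real (Suc j)" "Suc N" 1 p q]
    by (simp add: grid_def s_def del: of_nat_Suc upt_Suc sum.lessThan_Suc)
  have le: "ennreal (psi p s) \<le> psi_integral p q"
    using grid_average_le[where n = "Suc N" and p = p and q = q] unfolding eq by (simp del: of_nat_Suc)
  have "0 \<le> (\<Sum>i<Suc N. \<Sum>j<Suc N. grid p q (Suc N) i j)"
    by (intro sum_nonneg grid_nonneg) auto
  then have psi_s: "0 \<le> psi p s" unfolding eq by (simp add: zero_le_mult_iff)
  from assms show ?thesis
  proof (cases rule: rho_cases[where q = q])
    case (2 R)
    then have "psi p s \<le> psi p R"
      using le psi_s psi_nonneg[of R p] by simp
    then show ?thesis using 2 s by (subst (asm) psi_le_iff) (auto simp: s_def)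
  qed simp
qed

text \<open>\<open>K\<close> below \<open>rho\<close> puts \<open>psi p K\<close> strictly below
  \<open>psi_integral\<close>, hence below the lower limit of the off-diagonal averages.\<close>

lemma eventually_offdiagonal_average_ge:
  assumes "p \<le> 1" "0 < K" "ereal K < rho p q"
  shows "eventually (\<lambda>n. psi p K * (real n)\<^sup>2 \<le> (\<Sum>i<n. \<Sum>j<n. if i = j then 0 else grid p q n i j)) sequentially"
proof (cases "1 \<le> K")
  \<comment> \<open>Here \<open>psi p K\<close> is negative and would be truncated in
    \<open>ennreal\<close>, but the sums are nonnegative.\<close>
  case False
  then have "psi p K < 0" using psi_less[of K 1 p] assms by simp
  then have "psi p K * (real n)\<^sup>2 \<le> 0" for n by (simp add: mult_nonpos_nonneg)
  moreover have "0 \<le> (\<Sum>i<n. \<Sum>j<n. if i = j then 0 else grid p q n i j)" for n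
    by (intro sum_nonneg) (auto intro: grid_nonneg)
  ultimately show ?thesis by (intro always_eventually) (auto intro: order_trans)
next
  case True
  have "ennreal (psi p K) < psi_integral p q"
    using assms(1)
  proof (cases rule: rho_cases[where q = q])
    case 1
    then show ?thesis by simp
  next
    case (2 R)
    then show ?thesis
      using assms psi_less[of K R p] psi_nonneg[OF True, of p] by (simp add: ennreal_less_iff)
  qed
  also note psi_integral_le_liminf
  finally have "eventually (\<lambda>n. ennreal (psi p K)
      < ennreal ((\<Sum>i<n. \<Sum>j<n. if i = j then 0 else grid p q n i j) / (real n)\<^sup>2)) sequentially"
    by (rule less_LiminfD)
  then show ?thesis
    using eventually_gt_at_top[of 0]
  proof eventually_elim
    case (elim n)
    then show ?case
      using psi_nonneg[OF True, of p] by (simp add: ennreal_less_iff pos_less_divide_eq)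
  qed
qed

lemma psi_grid:
  assumes "0 < n"
  shows "psi p (real n * mean2 q (1 / real (Suc i)) (1 / real (Suc j))) = grid p q n i j"
  unfolding grid_def using assms mean2_mult[of "1 / real (Suc i)" "1 / real (Suc j)" "real n" q] by simp

lemma eventually_square_mean_ge:
  assumes "p \<le> 1" "0 < K" "ereal K < rho p q"
  shows "eventually (\<lambda>n. K \<le> real n * square_mean p q (map (\<lambda>k. 1 / real (Suc k)) [0..<n])) sequentially"
  using eventually_offdiagonal_average_ge[OF assms] eventually_gt_at_top[of 0]
proof eventually_elim
  case (elim n)
  let ?s = "square_mean p q (map (\<lambda>k. 1 / real (Suc k)) [0..<n])"
  have s: "0 < ?s" using elim by (intro square_mean_pos) auto
  \<comment> \<open>Restoring the nonnegative diagonal terms only enlarges the sum.\<close>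
  have "psi p K * (real n)\<^sup>2 \<le> (\<Sum>i<n. \<Sum>j<n. grid p q n i j)"
    using elim(1) by (rule order_trans) (intro sum_mono, auto intro: grid_nonneg)
  also have "\<dots> = (real n)\<^sup>2 * psi p (real n * ?s)"
    using psi_square_mean_scaled(1)[of "\<lambda>k. 1 / real (Suc k)" n "real n" p q] elim
    by (simp add: psi_grid del: of_nat_Suc)
  finally have "psi p K \<le> psi p (real n * ?s)" using elim by (simp add: mult.commute)
  then show ?case using assms s elim by (subst (asm) psi_le_iff) auto
qed

lemma eventually_circ_mean_ge:
  assumes "p \<le> 1" "0 < K" "ereal K < rho p q"
  shows "eventually (\<lambda>n. K \<le> real n * circ_mean p q (map (\<lambda>k. 1 / real (Suc k)) [0..<n])) sequentially"
  using eventually_offdiagonal_average_ge[OF assms] eventually_ge_at_top[of 2]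
proof eventually_elim
  case (elim n)
  let ?s = "circ_mean p q (map (\<lambda>k. 1 / real (Suc k)) [0..<n])"
  let ?T = "\<Sum>i<n. \<Sum>j\<in>{Suc i..<n}. grid p q n i j"
  have s: "0 < ?s" using elim by (intro circ_mean_pos) auto
  have "(\<Sum>i<n. \<Sum>j<n. if i = j then 0 else grid p q n i j)
      = 2 * (\<Sum>i<n. \<Sum>j\<in>{Suc i..<n}. if i = j then 0 else grid p q n i j)"
    by (subst sum_square_symmetric) (auto simp: grid_def mean2_commute)
  also have "\<dots> = 2 * ?T"
    by (intro arg_cong[where f = "(*) 2"] sum.cong) auto
  finally have T: "(\<Sum>i<n. \<Sum>j<n. if i = j then 0 else grid p q n i j) = 2 * ?T" .
  have eq: "2 * ?T = real n * (real n - 1) * psi p (real n * ?s)"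
    using psi_circ_mean_scaled(1)[of "\<lambda>k. 1 / real (Suc k)" n "real n" p q] elim
    by (simp add: psi_grid del: of_nat_Suc)
  \<comment> \<open>Nonnegativity of \<open>psi p (real n * ?s)\<close> is what allows the count
    \<open>n * (n - 1)\<close> of ordered pairs to be enlarged to the square of \<open>n\<close>
    below.\<close>
  have "0 \<le> ?T" by (intro sum_nonneg grid_nonneg) auto
  then have "0 \<le> real n * (real n - 1) * psi p (real n * ?s)"
    unfolding eq[symmetric] by simp
  moreover have "0 < real n * (real n - 1)" using elim(2) by simp
  ultimately have nonneg: "0 \<le> psi p (real n * ?s)"
    unfolding zero_le_mult_iff by linarith
  have "(real n)\<^sup>2 * psi p K \<le> real n * (real n - 1) * psi p (real n * ?s)"
    using elim(1) unfolding T eq by (simp add: mult.commute)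
  also have "\<dots> \<le> (real n)\<^sup>2 * psi p (real n * ?s)"
    using nonneg by (intro mult_right_mono) (auto simp: power2_eq_square algebra_simps)
  finally have "psi p K \<le> psi p (real n * ?s)" using elim by simp
  then show ?case using assms s elim by (subst (asm) psi_le_iff) auto
qed

lemma rho_pos: "p \<le> 1 \<Longrightarrow> 0 < rho p q"
  by (erule rho_cases[where q = q]) auto

lemma sum_square_mean_le_rho:
  assumes "p \<le> 1" "q \<le> 1" "\<And>i. 0 < x i"
  shows "ereal (\<Sum>n\<le>N. square_mean p q (map x [0..<Suc n])) \<le> rho p q * ereal (\<Sum>k\<le>N. x k)"
proof -
  let ?s = "square_mean p q (map (\<lambda>j. real (Suc N) / real (Suc j)) [0..<Suc N])"
  have "0 \<le> (\<Sum>k\<le>N. x k)" using assms by (intro sum_nonneg) (auto intro: less_imp_le)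
  have "ereal (\<Sum>n\<le>N. square_mean p q (map x [0..<Suc n])) \<le> ereal ?s * ereal (\<Sum>k\<le>N. x k)"
    using sum_square_mean_le[of p q x N] assms by (simp add: mult.commute del: upt_Suc of_nat_Suc)
  also have "\<dots> \<le> rho p q * ereal (\<Sum>k\<le>N. x k)"
    using assms \<open>0 \<le> (\<Sum>k\<le>N. x k)\<close> by (intro ereal_mult_right_mono square_mean_le_rho) auto
  finally show ?thesis .
qed

theorem theorem2:
  fixes p q :: real
  assumes "p \<le> 1" and "q \<le> 1"
  shows "hardy_const (mean_square (power_mean p) (\<lambda>x y. power_mean q [x, y])) = rho p q \<and>
    (p > q \<longrightarrow> hardy_const (mean_circ (power_mean p) (\<lambda>x y. power_mean q [x, y])) = rho p q)"
proof (intro conjI impI hardy_const_eqI rho_pos assms(1))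
  fix x :: "nat \<Rightarrow> real" and n :: nat
  assume x: "\<And>i. 0 < x i"
  show "0 < square_mean p q (map x [0..<Suc n])"
    using x by (intro square_mean_pos) auto
  show "0 < circ_mean p q (map x [0..<Suc n])"
    using x by (intro circ_mean_pos) auto
next
  fix x :: "nat \<Rightarrow> real" and N :: nat
  assume x: "\<And>i. 0 < x i"
  show square: "ereal (\<Sum>n\<le>N. square_mean p q (map x [0..<Suc n])) \<le> rho p q * ereal (\<Sum>k\<le>N. x k)"
    using sum_square_mean_le_rho[OF assms] x by blast
  \<comment> \<open>The comparison of the two mixed means transfers the bound just shown.\<close>
  assume "q < p"
  then have "(\<Sum>n\<le>N. circ_mean p q (map x [0..<Suc n])) \<le> (\<Sum>n\<le>N. square_mean p q (map x [0..<Suc n]))"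
    using x by (intro sum_mono circ_mean_le_square_mean) auto
  then show "ereal (\<Sum>n\<le>N. circ_mean p q (map x [0..<Suc n])) \<le> rho p q * ereal (\<Sum>k\<le>N. x k)"
    using square order_trans[of "ereal (\<Sum>n\<le>N. circ_mean p q (map x [0..<Suc n]))"
        "ereal (\<Sum>n\<le>N. square_mean p q (map x [0..<Suc n]))"] by (simp del: upt_Suc)
next
  fix K :: real
  assume K: "0 < K" "ereal K < rho p q"
  show "eventually (\<lambda>n. K \<le> real (Suc n) * square_mean p q (map (\<lambda>k. 1 / real (Suc k)) [0..<Suc n])) sequentially"
    using eventually_square_mean_ge[OF assms(1) K] by (rule eventually_sequentially_Suc[THEN iffD2])
  show "eventually (\<lambda>n. K \<le> real (Suc n) * circ_mean p q (map (\<lambda>k. 1 / real (Suc k)) [0..<Suc n])) sequentially"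
    using eventually_circ_mean_ge[OF assms(1) K] by (rule eventually_sequentially_Suc[THEN iffD2])
qed

end
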